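(* Let $f=f^*\in A_\theta^\infty$ and $0\le t<1$, and equip $\mathcal X_\theta$ with the Riemannian metric $$g=\begin{pmatrix}e^f&t\\t&e^{-f}\end{pmatrix}$$ and its associated Levi-Civita connection. Then the Gauss–Bonnet theorem holds for each such $t$: $\tau(R\sqrt{\det g})=0$, where $R$ is the scalar curvature and $\sqrt{\det g}=(1-t^2)^{1/2}$.
   Context: Let $\theta\in\mathbb R$. $A_\theta$ is the universal unital $C^*$-algebra generated by unitaries $U,V$ with $UV=e^{2\pi i\theta}VU$; $A_\theta^\infty=\{\sum_{m,n}a_{mn}U^mV^n:(a_{mn})\text{ rapidly decreasing}\}$; $\tau(\sum a_{mn}U^mV^n)=a_{00}$ is the canonical faithful trace. The canonical derivations are determined by $\partial_1U=2\pi iU$, $\partial_1V=0$, $\partial_2U=0$, $\partial_2V=2\pi iV$. $\mathcal X_\theta$ is the free left $A_\theta^\infty$-module with basis also denoted $\partial_1,\partial_2$. A Riemannian metric is a sesquilinear map $\langle\cdot,\cdot\rangle:\mathcal X_\theta\times\mathcal X_\theta\to A_\theta^\infty$ with $\langle aX,Y\rangle=a\langle X,Y\rangle$, $\langle X,Y\rangle=\langle Y,X\rangle^*$, $\langle X,X\rangle\ge0$ with equality only for $X=0$, and $\langle\partial_i,\partial_j\rangle=\langle\partial_j,\partial_i\rangle$; $g_{ij}=\langle\partial_i,\partial_j\rangle$, and $(g^{ij})$ is the inverse matrix of $(g_{ij})$, here $g^{-1}=\frac1{1-t^2}\begin{pmatrix}e^{-f}&-t\\-t&e^f\end{pmatrix}$.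 The Levi-Civita connection is given by $\mathbb C$-linear operators $\nabla_i=\nabla_{\partial_i}$ on $\mathcal X_\theta$ with $\nabla_i(aX)=\partial_i(a)X+a\nabla_iX$ and $\langle\nabla_i\partial_j,\partial_k\rangle=\frac12\{\partial_ig_{jk}+\partial_jg_{ik}-\partial_kg_{ij}\}$. Put $R_{ijkl}=\langle(\nabla_j\nabla_i-\nabla_i\nabla_j)\partial_k,\partial_l\rangle$. The scalar curvature is $R=\sum_{i,j,k,l}g^{ij}g^{kl}R_{ikjl}$. *)

theory Defs
  imports "HOL-Analysis.Analysis"
begin

section \<open>Unital C*-algebras\<close>

text \<open>Explicit carriers are needed because the universal property of the noncommutative torus
  quantifies over C*-algebras inside a formula. The zero algebra is allowed here.\<close>

locale unital_cstar_algebra =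
  fixes B :: "'b set"
    and add :: "'b \<Rightarrow> 'b \<Rightarrow> 'b"
    and zero :: 'b
    and scl :: "complex \<Rightarrow> 'b \<Rightarrow> 'b"
    and mul :: "'b \<Rightarrow> 'b \<Rightarrow> 'b"
    and one :: 'b
    and adj :: "'b \<Rightarrow> 'b"
    and nrm :: "'b \<Rightarrow> real"
  assumes zero_closed: "zero \<in> B"
    and one_closed: "one \<in> B"
    and add_closed: "\<lbrakk>x \<in> B; y \<in> B\<rbrakk> \<Longrightarrow> add x y \<in> B"
    and scl_closed: "x \<in> B \<Longrightarrow> scl c x \<in> B"
    and mul_closed: "\<lbrakk>x \<in> B; y \<in> B\<rbrakk> \<Longrightarrow> mul x y \<in> B"
    and adj_closed: "x \<in> B \<Longrightarrow> adj x \<in> B"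
    and add_assoc: "\<lbrakk>x \<in> B; y \<in> B; z \<in> B\<rbrakk> \<Longrightarrow> add (add x y) z = add x (add y z)"
    and add_commute: "\<lbrakk>x \<in> B; y \<in> B\<rbrakk> \<Longrightarrow> add x y = add y x"
    and add_zero: "x \<in> B \<Longrightarrow> add zero x = x"
    and add_uminus: "x \<in> B \<Longrightarrow> add x (scl (- 1) x) = zero"
    and scl_one: "x \<in> B \<Longrightarrow> scl 1 x = x"
    and scl_scl: "x \<in> B \<Longrightarrow> scl c (scl d x) = scl (c * d) x"
    and scl_add_left: "x \<in> B \<Longrightarrow> scl (c + d) x = add (scl c x) (scl d x)"
    and scl_add_right: "\<lbrakk>x \<in> B; y \<in> B\<rbrakk> \<Longrightarrow> scl c (add x y) = add (scl c x) (scl c y)"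
    and mul_assoc: "\<lbrakk>x \<in> B; y \<in> B; z \<in> B\<rbrakk> \<Longrightarrow> mul (mul x y) z = mul x (mul y z)"
    and mul_one_left: "x \<in> B \<Longrightarrow> mul one x = x"
    and mul_one_right: "x \<in> B \<Longrightarrow> mul x one = x"
    and mul_add_left: "\<lbrakk>x \<in> B; y \<in> B; z \<in> B\<rbrakk> \<Longrightarrow> mul (add x y) z = add (mul x z) (mul y z)"
    and mul_add_right: "\<lbrakk>x \<in> B; y \<in> B; z \<in> B\<rbrakk> \<Longrightarrow> mul z (add x y) = add (mul z x) (mul z y)"
    and mul_scl_left: "\<lbrakk>x \<in> B; y \<in> B\<rbrakk> \<Longrightarrow> mul (scl c x) y = scl c (mul x y)"
    and mul_scl_right: "\<lbrakk>x \<in> B; y \<in> B\<rbrakk> \<Longrightarrow> mul x (scl c y) = scl c (mul x y)"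
    and adj_adj: "x \<in> B \<Longrightarrow> adj (adj x) = x"
    and adj_add: "\<lbrakk>x \<in> B; y \<in> B\<rbrakk> \<Longrightarrow> adj (add x y) = add (adj x) (adj y)"
    and adj_scl: "x \<in> B \<Longrightarrow> adj (scl c x) = scl (cnj c) (adj x)"
    and adj_mul: "\<lbrakk>x \<in> B; y \<in> B\<rbrakk> \<Longrightarrow> adj (mul x y) = mul (adj y) (adj x)"
    and nrm_nonneg: "x \<in> B \<Longrightarrow> 0 \<le> nrm x"
    and nrm_eq_zero: "x \<in> B \<Longrightarrow> nrm x = 0 \<longleftrightarrow> x = zero"
    and nrm_add: "\<lbrakk>x \<in> B; y \<in> B\<rbrakk> \<Longrightarrow> nrm (add x y) \<le> nrm x + nrm y"
    and nrm_scl: "x \<in> B \<Longrightarrow> nrm (scl c x) = cmod c * nrm x"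
    and nrm_mul: "\<lbrakk>x \<in> B; y \<in> B\<rbrakk> \<Longrightarrow> nrm (mul x y) \<le> nrm x * nrm y"
    and cstar_identity: "x \<in> B \<Longrightarrow> nrm (mul (adj x) x) = (nrm x)\<^sup>2"
    and complete: "\<And>X :: nat \<Rightarrow> 'b.
          \<lbrakk>\<And>n. X n \<in> B; \<forall>e>0. \<exists>N. \<forall>m\<ge>N. \<forall>n\<ge>N. nrm (add (X m) (scl (- 1) (X n))) < e\<rbrakk>
            \<Longrightarrow> \<exists>l\<in>B. (\<lambda>n. nrm (add (X n) (scl (- 1) l))) \<longlonglongrightarrow> 0"

text \<open>Types that are nonzero unital C*-algebras (the superclass forces \<open>norm 1 = 1\<close>).\<close>

class cstar_algebra = real_normed_algebra_1 + banach +
  fixes scaleC :: "complex \<Rightarrow> 'a \<Rightarrow> 'a"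
    and star :: "'a \<Rightarrow> 'a"
  assumes scaleR_scaleC: "scaleR r x = scaleC (complex_of_real r) x"
    and unital_cstar_algebra_UNIV:
      "unital_cstar_algebra UNIV (+) 0 scaleC (*) 1 star norm"

definition star_hom_into ::
  "'a::cstar_algebra set \<Rightarrow> ('a \<Rightarrow> 'a \<Rightarrow> 'a) \<Rightarrow> (complex \<Rightarrow> 'a \<Rightarrow> 'a) \<Rightarrow> ('a \<Rightarrow> 'a \<Rightarrow> 'a) \<Rightarrow> 'a \<Rightarrow>
    ('a \<Rightarrow> 'a) \<Rightarrow> ('a \<Rightarrow> 'a) \<Rightarrow> bool" where
  "star_hom_into B add scl mul one adj \<phi> \<longleftrightarrow>
     (\<forall>x. \<phi> x \<in> B) \<and>
     (\<forall>x y. \<phi> (x + y) = add (\<phi> x) (\<phi> y)) \<and>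
     (\<forall>c x. \<phi> (scaleC c x) = scl c (\<phi> x)) \<and>
     (\<forall>x y. \<phi> (x * y) = mul (\<phi> x) (\<phi> y)) \<and>
     \<phi> 1 = one \<and>
     (\<forall>x. \<phi> (star x) = adj (\<phi> x))"

definition star_subalgebra :: "'a::cstar_algebra set \<Rightarrow> bool" where
  "star_subalgebra S \<longleftrightarrow>
     1 \<in> S \<and>
     (\<forall>x\<in>S. \<forall>y\<in>S. x + y \<in> S \<and> x * y \<in> S) \<and>
     (\<forall>c. \<forall>x\<in>S. scaleC c x \<in> S) \<and>
     (\<forall>x\<in>S. star x \<in> S)"

definition cstar_positive :: "'a::cstar_algebra \<Rightarrow> bool" where
  "cstar_positive a \<longleftrightarrow> (\<exists>b. a = star b * b)"


section \<open>The noncommutative torus\<close>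

definition torus_relations ::
  "real \<Rightarrow> (complex \<Rightarrow> 'b \<Rightarrow> 'b) \<Rightarrow> ('b \<Rightarrow> 'b \<Rightarrow> 'b) \<Rightarrow> 'b \<Rightarrow> ('b \<Rightarrow> 'b) \<Rightarrow> 'b \<Rightarrow> 'b \<Rightarrow> bool" where
  "torus_relations \<theta> scl mul one adj u v \<longleftrightarrow>
     mul (adj u) u = one \<and> mul u (adj u) = one \<and>
     mul (adj v) v = one \<and> mul v (adj v) = one \<and>
     mul u v = scl (exp (2 * pi * \<i> * \<theta>)) (mul v u)"

text \<open>The type \<open>'a\<close> with \<open>U\<close>, \<open>V\<close> is the universal unital C*-algebra generated by two unitaries
  satisfying the commutation relation. The target algebras range over all C*-algebras whose
  carrier is a subset of \<open>'a\<close>. Up to isomorphism this loses nothing: the homomorphism out of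
  \<open>'a\<close> only sees the C*-subalgebra generated by \<open>u\<close>, \<open>v\<close>, which has at most continuum many
  elements, while the nonzero complex vector space \<open>'a\<close> has at least that many.
  Uniqueness of the homomorphism follows from generation by \<open>U\<close>, \<open>V\<close>, since
  *-homomorphisms between C*-algebras are contractive.\<close>

definition noncommutative_torus :: "real \<Rightarrow> 'a::cstar_algebra \<Rightarrow> 'a \<Rightarrow> bool" where
  "noncommutative_torus \<theta> U V \<longleftrightarrow>
     torus_relations \<theta> scaleC (*) 1 star U V \<and>
     (\<forall>S. closed S \<and> star_subalgebra S \<and> U \<in> S \<and> V \<in> S \<longrightarrow> S = UNIV) \<and>
     (\<forall>(B :: 'a set) add zero scl mul one adj nrm u v.
        unital_cstar_algebra B add zero scl mul one adj nrm \<and> u \<in> B \<and> v \<in> B \<and>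
        torus_relations \<theta> scl mul one adj u v \<longrightarrow>
        (\<exists>\<phi>. star_hom_into B add scl mul one adj \<phi> \<and> \<phi> U = u \<and> \<phi> V = v))"

definition unitary_power :: "'a::cstar_algebra \<Rightarrow> int \<Rightarrow> 'a" where
  "unitary_power U m = (if 0 \<le> m then U ^ nat m else star U ^ nat (- m))"

definition torus_monomial :: "'a::cstar_algebra \<Rightarrow> 'a \<Rightarrow> int \<times> int \<Rightarrow> 'a" where
  "torus_monomial U V = (\<lambda>(m, n). unitary_power U m * unitary_power V n)"

definition rapidly_decreasing :: "(int \<times> int \<Rightarrow> complex) \<Rightarrow> bool" where
  "rapidly_decreasing c \<longleftrightarrow>
     (\<forall>k::nat. \<exists>C. \<forall>m n. (1 + \<bar>real_of_int m\<bar> + \<bar>real_of_int n\<bar>) ^ k * cmod (c (m, n)) \<le> C)"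

definition has_torus_expansion ::
  "'a::cstar_algebra \<Rightarrow> 'a \<Rightarrow> (int \<times> int \<Rightarrow> complex) \<Rightarrow> 'a \<Rightarrow> bool" where
  "has_torus_expansion U V c a \<longleftrightarrow>
     rapidly_decreasing c \<and> ((\<lambda>p. scaleC (c p) (torus_monomial U V p)) has_sum a) UNIV"

definition smooth_torus :: "'a::cstar_algebra \<Rightarrow> 'a \<Rightarrow> 'a set" where
  "smooth_torus U V = {a. \<exists>c. has_torus_expansion U V c a}"

definition torus_coeff :: "'a::cstar_algebra \<Rightarrow> 'a \<Rightarrow> 'a \<Rightarrow> int \<times> int \<Rightarrow> complex" where
  "torus_coeff U V a = (THE c. has_torus_expansion U V c a)"

definition torus_trace :: "'a::cstar_algebra \<Rightarrow> 'a \<Rightarrow> 'a \<Rightarrow> complex" where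
  "torus_trace U V a = torus_coeff U V a (0, 0)"

text \<open>The derivations \<open>\<partial>\<^sub>1\<close>, \<open>\<partial>\<^sub>2\<close> on the smooth torus: by the Leibniz rule the
  values on \<open>U\<close> and \<open>V\<close> give \<open>\<partial>\<^sub>1(U\<^sup>m V\<^sup>n) = 2\<pi>i m U\<^sup>m V\<^sup>n\<close> and
  \<open>\<partial>\<^sub>2(U\<^sup>m V\<^sup>n) = 2\<pi>i n U\<^sup>m V\<^sup>n\<close>, extended termwise to rapidly
  decreasing series.\<close>

definition torus_deriv :: "'a::cstar_algebra \<Rightarrow> 'a \<Rightarrow> 2 \<Rightarrow> 'a \<Rightarrow> 'a" where
  "torus_deriv U V i a =
     (\<Sum>\<^sub>\<infinity>p. scaleC (2 * pi * \<i> * of_int (if i = 1 then fst p else snd p) * torus_coeff U V a p)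
               (torus_monomial U V p))"


section \<open>Riemannian geometry\<close>

text \<open>The free left module on \<open>\<partial>\<^sub>1\<close>, \<open>\<partial>\<^sub>2\<close>: vectors of coefficients,
  with left multiplication \<open>a *s X\<close>.\<close>

definition vector_fields :: "'a::cstar_algebra \<Rightarrow> 'a \<Rightarrow> ('a ^ 2) set" where
  "vector_fields U V = {X. \<forall>i. X $ i \<in> smooth_torus U V}"

definition basis_field :: "2 \<Rightarrow> 'a::cstar_algebra ^ 2" where
  "basis_field i = axis i 1"

text \<open>Conjugate-linearity in the second argument follows from Hermitian symmetry.\<close>

definition riemannian_metric ::
  "'a::cstar_algebra \<Rightarrow> 'a \<Rightarrow> ('a ^ 2 \<Rightarrow> 'a ^ 2 \<Rightarrow> 'a) \<Rightarrow> bool" where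
  "riemannian_metric U V G \<longleftrightarrow>
     (\<forall>X\<in>vector_fields U V. \<forall>Y\<in>vector_fields U V. G X Y \<in> smooth_torus U V) \<and>
     (\<forall>X\<in>vector_fields U V. \<forall>Y\<in>vector_fields U V. \<forall>Z\<in>vector_fields U V.
        G (X + Y) Z = G X Z + G Y Z) \<and>
     (\<forall>a\<in>smooth_torus U V. \<forall>X\<in>vector_fields U V. \<forall>Y\<in>vector_fields U V.
        G (a *s X) Y = a * G X Y) \<and>
     (\<forall>X\<in>vector_fields U V. \<forall>Y\<in>vector_fields U V. G X Y = star (G Y X)) \<and>
     (\<forall>X\<in>vector_fields U V. cstar_positive (G X X) \<and> (G X X = 0 \<longrightarrow> X = 0)) \<and>
     (\<forall>i j. G (basis_field i) (basis_field j) = G (basis_field j) (basis_field i))"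

definition metric_matrix :: "('a::cstar_algebra ^ 2 \<Rightarrow> 'a ^ 2 \<Rightarrow> 'a) \<Rightarrow> 'a ^ 2 ^ 2" where
  "metric_matrix G = (\<chi> i j. G (basis_field i) (basis_field j))"

definition levi_civita_connection ::
  "'a::cstar_algebra \<Rightarrow> 'a \<Rightarrow> ('a ^ 2 \<Rightarrow> 'a ^ 2 \<Rightarrow> 'a) \<Rightarrow> (2 \<Rightarrow> 'a ^ 2 \<Rightarrow> 'a ^ 2) \<Rightarrow> bool" where
  "levi_civita_connection U V G D \<longleftrightarrow>
     (\<forall>i. \<forall>X\<in>vector_fields U V. D i X \<in> vector_fields U V) \<and>
     (\<forall>i. \<forall>X\<in>vector_fields U V. \<forall>Y\<in>vector_fields U V. D i (X + Y) = D i X + D i Y) \<and>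
     (\<forall>i c. \<forall>X\<in>vector_fields U V. D i (scaleC c 1 *s X) = scaleC c 1 *s D i X) \<and>
     (\<forall>i. \<forall>a\<in>smooth_torus U V. \<forall>X\<in>vector_fields U V.
        D i (a *s X) = torus_deriv U V i a *s X + a *s D i X) \<and>
     (\<forall>i j k. let g = metric_matrix G; \<delta> = torus_deriv U V in
        G (D i (basis_field j)) (basis_field k) =
          (1/2) *\<^sub>R (\<delta> i (g $ j $ k) + \<delta> j (g $ i $ k) - \<delta> k (g $ i $ j)))"

definition curvature ::
  "('a::cstar_algebra ^ 2 \<Rightarrow> 'a ^ 2 \<Rightarrow> 'a) \<Rightarrow> (2 \<Rightarrow> 'a ^ 2 \<Rightarrow> 'a ^ 2) \<Rightarrow> 2 \<Rightarrow> 2 \<Rightarrow> 2 \<Rightarrow> 2 \<Rightarrow> 'a" where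
  "curvature G D i j k l =
     G (D j (D i (basis_field k)) - D i (D j (basis_field k))) (basis_field l)"

text \<open>\<open>matrix_inv\<close> gives the two-sided inverse over the noncommutative ring \<open>'a\<close>;
  the order of the three factors below matters.\<close>

definition scalar_curvature ::
  "('a::cstar_algebra ^ 2 \<Rightarrow> 'a ^ 2 \<Rightarrow> 'a) \<Rightarrow> (2 \<Rightarrow> 'a ^ 2 \<Rightarrow> 'a ^ 2) \<Rightarrow> 'a" where
  "scalar_curvature G D =
     (let h = matrix_inv (metric_matrix G) in
       \<Sum>i\<in>UNIV. \<Sum>j\<in>UNIV. \<Sum>k\<in>UNIV. \<Sum>l\<in>UNIV. h $ i $ j * h $ k $ l * curvature G D i k j l)"

end

theory Submission
  imports Defs
begin

text \<open>
  The trace of the noncommutative torus vanishes on derivatives and is cyclic, and the curvature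
  of the metric is, up to derivatives, a quadratic expression in the Christoffel symbols whose
  trace is killed by cyclicity.

  \<^emph>\<open>The curvature.\<close> Write \<open>a = exp f\<close>, \<open>b = exp (- f)\<close> and \<open>s = 1 / (1 - t\<^sup>2)\<close>, and let
  \<open>\<Gamma> i j k = \<langle>\<nabla>\<^sub>i \<partial>\<^sub>j, \<partial>\<^sub>k\<rangle>\<close>. The off-diagonal entries of the metric are central and \<open>a\<close>, \<open>b\<close>
  are mutually inverse, so the scalar curvature collapses to \<open>s (R\<^sub>1\<^sub>2\<^sub>1\<^sub>2 - R\<^sub>1\<^sub>2\<^sub>2\<^sub>1)\<close>
  (\<open>scalar_curvature_eq\<close>). Metric compatibility rewrites each \<open>R\<^sub>i\<^sub>j\<^sub>k\<^sub>l\<close> as derivatives of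
  Christoffel symbols plus contractions \<open>\<Gamma> i k \<cdot> g\<inverse> \<cdot> \<Gamma> j l\<close> (\<open>curvature_eq\<close>). Four
  contractions survive under the trace, two with each sign. With \<open>\<partial> b = - b (\<partial> a) b\<close>, and with
  \<open>x\<close>, \<open>y\<close> for half the two derivatives of \<open>a\<close>, all four have the same trace
  \<open>s (\<tau> (x b b x b) + \<tau> (y y b) + 2 t \<tau> (y b x b))\<close>, whence the theorem
  (\<open>trace_scalar_curvature\<close>).

  \<^emph>\<open>The calculus.\<close> The trace and the derivations are defined through the coefficients of the
  expansion \<open>\<Sum> c\<^sub>m\<^sub>n U\<^sup>m V\<^sup>n\<close>, so everything rests on their uniqueness
  (\<open>expansion_unique\<close>). The universal property provides the gauge endomorphisms
  \<open>U \<mapsto> z U\<close>, \<open>V \<mapsto> w V\<close>; they are contractive, like all *-homomorphisms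
  (\<open>star_endomorphism_contractive\<close>), hence act termwise on convergent expansions, and averaging
  them over roots of unity isolates a single coefficient (\<open>fourier_coefficients_zero\<close>). Products
  then correspond to a twisted convolution of coefficients (\<open>expansion_mult\<close>), from which
  cyclicity of the trace and the Leibniz rule are read off.
\<close>


section \<open>Operations of a C*-algebra\<close>

interpretation cstar: unital_cstar_algebra
  "UNIV :: 'a::cstar_algebra set" "(+)" 0 scaleC "(*)" 1 star norm
  by (rule unital_cstar_algebra_UNIV)

lemmas scaleC_add_right = cstar.scl_add_right[OF UNIV_I UNIV_I]
lemmas scaleC_add_left = cstar.scl_add_left[OF UNIV_I]
lemmas scaleC_scaleC [simp] = cstar.scl_scl[OF UNIV_I]
lemmas scaleC_one [simp] = cstar.scl_one[OF UNIV_I]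
lemmas mult_scaleC_left [simp] = cstar.mul_scl_left[OF UNIV_I UNIV_I]
lemmas mult_scaleC_right [simp] = cstar.mul_scl_right[OF UNIV_I UNIV_I]
lemmas norm_scaleC [simp] = cstar.nrm_scl[OF UNIV_I]
lemmas star_star [simp] = cstar.adj_adj[OF UNIV_I]
lemmas star_add = cstar.adj_add[OF UNIV_I UNIV_I]
lemmas star_mult = cstar.adj_mul[OF UNIV_I UNIV_I]
lemmas star_scaleC = cstar.adj_scl[OF UNIV_I]
lemmas norm_star_mult_self = cstar.cstar_identity[OF UNIV_I]

lemma bounded_linear_scaleC_right: "bounded_linear (scaleC c :: 'a::cstar_algebra \<Rightarrow> 'a)"
  by (rule bounded_linear_intro[where K = "cmod c"])
     (simp_all add: scaleC_add_right scaleR_scaleC mult_ac)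

lemma bounded_linear_scaleC_left: "bounded_linear (\<lambda>c. scaleC c (x :: 'a::cstar_algebra))"
  by (rule bounded_linear_intro[where K = "norm x"])
     (simp_all add: scaleC_add_left scaleR_scaleC scaleR_conv_of_real)

lemma scaleC_zero_left [simp]: "scaleC 0 (x :: 'a::cstar_algebra) = 0"
  using bounded_linear.linear[OF bounded_linear_scaleC_left, THEN linear_0] .

lemma scaleC_minus_left: "scaleC (- c) (x :: 'a::cstar_algebra) = - scaleC c x"
  using bounded_linear.linear[OF bounded_linear_scaleC_left, THEN linear_neg] .

lemma scaleC_diff_right: "scaleC c (x - y :: 'a::cstar_algebra) = scaleC c x - scaleC c y"
  using bounded_linear.linear[OF bounded_linear_scaleC_right, THEN linear_diff] .

lemma star_one [simp]: "star (1 :: 'a::cstar_algebra) = 1"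
  by (metis mult.right_neutral mult_1 star_mult star_star)

lemma norm_star [simp]: "norm (star (x :: 'a::cstar_algebra)) = norm x"
proof -
  have le: "norm y \<le> norm (star y)" for y :: 'a
  proof (cases "y = 0")
    case False
    have "norm y * norm y \<le> norm (star y) * norm y"
      using norm_mult_ineq[of "star y" y] by (simp add: norm_star_mult_self power2_eq_square)
    then show ?thesis using False by simp
  qed simp
  show ?thesis using le[of x] le[of "star x"] by simp
qed

lemma bounded_linear_star: "bounded_linear (star :: 'a::cstar_algebra \<Rightarrow> 'a)"
  by (rule bounded_linear_intro[where K = 1])
     (simp_all add: star_add scaleR_scaleC star_scaleC)

lemma star_power: "star (x ^ n) = star (x :: 'a::cstar_algebra) ^ n"
  by (induction n) (simp_all add: star_mult power_commutes)

lemma norm_unitary: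
  fixes u :: "'a::cstar_algebra"
  assumes "star u * u = 1"
  shows "norm u = 1"
  using norm_star_mult_self[of u] assms by (simp add: power2_eq_1_iff) (smt (verit) norm_ge_zero)


section \<open>Contractivity of *-homomorphisms\<close>

text \<open>The binomial series of \<open>sqrt (1 - x)\<close> converges in the open unit ball of any Banach
  algebra; Vandermonde's identity for the Cauchy product says that its square is \<open>1 - x\<close>.\<close>

lemma sqrt_one_minus_exists:
  fixes x :: "'a::{real_normed_algebra_1,banach}"
  assumes "norm x < 1"
  obtains c :: "nat \<Rightarrow> real" where "summable (\<lambda>n. norm (c n *\<^sub>R x ^ n))"
    and "(\<Sum>n. c n *\<^sub>R x ^ n) * (\<Sum>n. c n *\<^sub>R x ^ n) = 1 - x"
proof -
  define c :: "nat \<Rightarrow> real" where "c n = ((1/2) gchoose n) * (-1) ^ n" for n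
  have half: "(1/2 :: real) \<notin> \<nat>"
  proof
    assume "(1/2 :: real) \<in> \<nat>"
    then obtain n :: nat where "(1/2::real) = of_nat n" by (auto elim: Nats_cases)
    then have "real (2 * n) = real 1" by simp
    then have "2 * n = 1" by (simp only: of_nat_eq_iff)
    then show False by presburger
  qed
  have "summable (\<lambda>n. norm (((1/2 :: real) gchoose n) * norm x ^ n))"
    by (rule abs_summable_in_conv_radius) (simp add: conv_radius_gchoose half assms)
  then have summable: "summable (\<lambda>n. norm (c n *\<^sub>R x ^ n))"
    by (rule summable_comparison_test'[where N = 0])
       (auto simp: c_def abs_mult power_abs intro!: mult_left_mono norm_power_ineq)
  have conv: "(\<Sum>i\<le>k. c i * c (k - i)) = (if k = 0 then 1 else if k = 1 then -1 else 0)" for k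
  proof -
    have "(\<Sum>i\<le>k. c i * c (k - i)) = (-1) ^ k * (\<Sum>i\<le>k. ((1/2) gchoose i) * ((1/2) gchoose (k - i)))"
      unfolding sum_distrib_left c_def
      by (intro sum.cong refl) (simp flip: power_add)
    also have "\<dots> = (-1) ^ k * (1 gchoose k)"
      using gbinomial_Vandermonde[of "1/2::real" "1/2" k] by (simp add: atMost_atLeast0)
    also have "(1 gchoose k :: real) = of_nat (1 choose k)"
      using binomial_gbinomial[of 1 k, where 'a = real] by simp
    finally show ?thesis by (cases k) (auto simp: binomial_eq_0 split: nat.splits)
  qed
  have "(\<lambda>k. \<Sum>i\<le>k. (c i *\<^sub>R x ^ i) * (c (k - i) *\<^sub>R x ^ (k - i))) sums
      ((\<Sum>n. c n *\<^sub>R x ^ n) * (\<Sum>n. c n *\<^sub>R x ^ n))"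
    by (rule Cauchy_product_sums[OF summable summable])
  moreover have "(\<Sum>i\<le>k. (c i *\<^sub>R x ^ i) * (c (k - i) *\<^sub>R x ^ (k - i)))
      = (if k = 0 then 1 else if k = 1 then -1 else 0) *\<^sub>R x ^ k" for k
    unfolding conv[symmetric] scaleR_sum_left
    by (intro sum.cong refl) (simp add: flip: power_add)
  moreover have "(\<lambda>k. (if k = 0 then 1 else if k = 1 then -1 else 0) *\<^sub>R x ^ k) sums
      (\<Sum>k\<in>{0,1}. (if k = 0 then 1 else if k = 1 then -1 else 0) *\<^sub>R x ^ k)"
    by (rule sums_finite) auto
  ultimately have "(\<Sum>n. c n *\<^sub>R x ^ n) * (\<Sum>n. c n *\<^sub>R x ^ n) = 1 - x"
    by (simp add: sums_iff)
  then show ?thesis using that summable by blast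
qed

lemma selfadjoint_unitary_completion:
  fixes a :: "'a::cstar_algebra"
  assumes "star a = a" "norm a < 1"
  obtains y where "star y = y" "y * a = a * y" "a * a + y * y = 1"
proof -
  have "norm (a * a) = norm a ^ 2"
    using norm_star_mult_self[of a] assms(1) by simp
  then have "norm (a * a) < 1"
    using assms(2) by (simp add: power_less_one_iff)
  then obtain c where c: "summable (\<lambda>n. norm (c n *\<^sub>R (a * a) ^ n))"
      "(\<Sum>n. c n *\<^sub>R (a * a) ^ n) * (\<Sum>n. c n *\<^sub>R (a * a) ^ n) = 1 - a * a"
    by (rule sqrt_one_minus_exists)
  define y where "y = (\<Sum>n. c n *\<^sub>R (a * a) ^ n)"
  note s = summable_norm_cancel[OF c(1)]
  have "star y = y"
    unfolding y_def bounded_linear.suminf[OF bounded_linear_star s]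
    by (simp add: bounded_linear.linear[OF bounded_linear_star, THEN linear_scale]
        star_power star_mult assms)
  moreover have "y * a = a * y"
    unfolding y_def suminf_mult2[OF s] suminf_mult[OF s, symmetric]
    by (simp add: power_commuting_commutes mult.assoc)
  moreover have "a * a + y * y = 1" using c(2) by (simp add: y_def)
  ultimately show ?thesis by (rule that)
qed

abbreviation star_endomorphism :: "('a::cstar_algebra \<Rightarrow> 'a) \<Rightarrow> bool" where
  "star_endomorphism \<equiv> star_hom_into UNIV (+) scaleC (*) 1 star"

text \<open>A self-adjoint \<open>a\<close> in the open unit ball is the real part of the unitary
  \<open>a + \<i> sqrt (1 - a\<^sup>2)\<close>. A *-homomorphism maps that unitary to a unitary, whose real part
  has norm at most 1. The C*-identity extends the estimate from self-adjoint elements to all.\<close>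

lemma star_endomorphism_contractive:
  fixes \<phi> :: "'a::cstar_algebra \<Rightarrow> 'a"
  assumes "star_endomorphism \<phi>"
  shows "norm (\<phi> x) \<le> norm x"
proof -
  have add: "\<phi> (x + y) = \<phi> x + \<phi> y" and scal: "\<phi> (scaleC c x) = scaleC c (\<phi> x)"
    and mult: "\<phi> (x * y) = \<phi> x * \<phi> y" and one: "\<phi> 1 = 1"
    and star: "\<phi> (star x) = star (\<phi> x)" for x y c
    using assms by (auto simp: star_hom_into_def)
  have ball: "norm (\<phi> a) \<le> 1" if a: "star a = a" "norm a < 1" for a
  proof -
    obtain y where y: "star y = y" "y * a = a * y" "a * a + y * y = 1"
      using selfadjoint_unitary_completion[OF a] .
    define u where "u = \<phi> a + scaleC \<i> (\<phi> y)"
    define w where "w = \<phi> a + scaleC (- \<i>) (\<phi> y)"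
    have eqs: "\<phi> y * \<phi> a = \<phi> a * \<phi> y" "\<phi> a * \<phi> a + \<phi> y * \<phi> y = 1"
      by (simp_all flip: mult add add: y one)
    have su: "star u = w"
      using star[of a] star[of y] by (simp add: u_def w_def a y star_add star_scaleC)
    have "w * u = \<phi> a * \<phi> a + \<phi> y * \<phi> y"
      by (simp add: u_def w_def algebra_simps eqs(1) scaleC_add_right scaleC_diff_right scaleC_minus_left)
    then have "star u * u = 1" using eqs su by simp
    then have "norm u = 1" by (rule norm_unitary)
    moreover from this have "norm w = 1" by (simp flip: su)
    moreover have "u + w = \<phi> a + \<phi> a" by (simp add: u_def w_def scaleC_minus_left)
    then have "2 *\<^sub>R \<phi> a = u + w" by (simp add: scaleR_2)
    then have "2 * norm (\<phi> a) = norm (u + w)" by (metis norm_scaleR abs_numeral)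
    ultimately show ?thesis using norm_triangle_ineq[of u w] by simp
  qed
  have sa: "norm (\<phi> a) \<le> norm a" if a: "star a = a" for a
  proof (rule field_le_mult_one_interval)
    fix z :: real assume z: "0 < z" "z < 1"
    show "z * norm (\<phi> a) \<le> norm a"
    proof (cases "a = 0")
      case True
      then show ?thesis using scal[of 0 0] by simp
    next
      case False
      define r where "r = z / norm a"
      have r: "r > 0" using False z by (simp add: r_def)
      have "norm (\<phi> (scaleC (of_real r) a)) \<le> 1"
        by (rule ball) (use r z False in \<open>simp_all add: star_scaleC a r_def norm_divide\<close>)
      then have "r * norm (\<phi> a) \<le> 1" using r by (simp add: scal)
      then show ?thesis using False by (simp add: r_def field_simps)
    qed
  qed
  have "(norm (\<phi> x))\<^sup>2 = norm (\<phi> (star x * x))" by (simp add: mult star norm_star_mult_self)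
  also have "\<dots> \<le> norm (star x * x)" by (rule sa) (simp add: star_mult)
  also have "\<dots> = (norm x)\<^sup>2" by (rule norm_star_mult_self)
  finally show ?thesis by (rule power2_le_imp_le) simp
qed

lemma star_endomorphism_bounded_linear:
  "star_endomorphism \<phi> \<Longrightarrow> bounded_linear \<phi>"
  by (rule bounded_linear_intro[where K = 1])
     (simp_all add: star_endomorphism_contractive, simp_all add: star_hom_into_def scaleR_scaleC)


section \<open>Monomials in two commuting-up-to-phase unitaries\<close>

context
  fixes u :: "'a::cstar_algebra"
  assumes unitary: "star u * u = 1" "u * star u = 1"
begin

lemma unitary_cancel: "star u * (u * x) = x" "u * (star u * x) = x"
  by (simp_all add: unitary flip: mult.assoc)

lemma unitary_power_succ: "unitary_power u (m + 1) = u * unitary_power u m"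
proof (cases "0 \<le> m")
  case True
  then show ?thesis by (simp add: unitary_power_def nat_add_distrib)
next
  case False
  then obtain k where m: "m = - int (Suc k)"
    by (metis negD not_le)
  have "nat (- m) = Suc k" "nat (- (m + 1)) = k" by (simp_all add: m)
  then show ?thesis using False by (auto simp: unitary_power_def unitary_cancel)
qed

lemma unitary_power_pred: "unitary_power u (m - 1) = star u * unitary_power u m"
  using unitary_power_succ[of "m - 1"] by (simp add: unitary_cancel)

lemma unitary_power_add: "unitary_power u (m + n) = unitary_power u m * unitary_power u n"
proof (induction m rule: int_induct[where k = 0])
  case base
  then show ?case by (simp add: unitary_power_def)
next
  case (step1 i)
  have "unitary_power u (i + 1 + n) = unitary_power u (i + n + 1)" by (simp add: algebra_simps)
  then show ?case using step1 by (simp add: unitary_power_succ mult.assoc)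
next
  case (step2 i)
  have "unitary_power u (i - 1 + n) = unitary_power u (i + n - 1)" by (simp add: algebra_simps)
  then show ?case using step2 by (simp add: unitary_power_pred mult.assoc)
qed

lemma star_unitary_power: "star (unitary_power u m) = unitary_power u (- m)"
  by (auto simp: unitary_power_def star_power)

lemma unitary_power_unitary: "star (unitary_power u m) * unitary_power u m = 1"
  using unitary_power_add[of "- m" m] by (simp add: star_unitary_power) (simp add: unitary_power_def)

lemma unitary_power_commute_phase:
  assumes "x * u = scaleC w (u * x)" "w \<noteq> 0"
  shows "x * unitary_power u m = scaleC (w powi m) (unitary_power u m * x)"
proof (induction m rule: int_induct[where k = 0])
  case base
  then show ?case by (simp add: unitary_power_def)
next
  case (step1 i)
  have "x * unitary_power u (i + 1) = scaleC w (u * (x * unitary_power u i))"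
    by (simp add: unitary_power_succ assms(1) flip: mult.assoc)
  then show ?case
    using step1 assms(2) by (simp add: unitary_power_succ power_int_add mult.assoc mult.commute)
next
  case (step2 i)
  \<comment> \<open>Conjugating the relation by \<open>star u\<close> gives the same relation for \<open>star u\<close>, with inverse phase.\<close>
  have "scaleC w (star u * (x * u) * star u) = scaleC (w * w) (star u * (u * x) * star u)"
    by (simp add: assms(1))
  also have "star u * (u * x) * star u = x * star u" by (simp add: unitary_cancel)
  also have "star u * (x * u) * star u = star u * x"
    by (simp add: mult.assoc unitary)
  finally have "scaleC (inverse w * inverse w) (scaleC w (star u * x))
      = scaleC (inverse w * inverse w) (scaleC (w * w) (x * star u))" by simp
  then have xs: "x * star u = scaleC (inverse w) (star u * x)"
    using assms(2) by (simp add: field_simps)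
  have "x * unitary_power u (i - 1) = scaleC (inverse w) (star u * (x * unitary_power u i))"
    by (simp add: unitary_power_pred xs flip: mult.assoc)
  then show ?case
    using step2 assms(2)
    by (simp add: unitary_power_pred power_int_diff mult.assoc divide_inverse mult.commute)
qed

lemma unitary_power_scaleC:
  assumes "cmod z = 1"
  shows "unitary_power (scaleC z u) m = scaleC (z powi m) (unitary_power u m)"
proof -
  have pow: "scaleC c x ^ n = scaleC (c ^ n) (x ^ n)" for c n and x :: 'a
    by (induction n) (simp_all add: mult_ac)
  have "cnj z = inverse z"
    using complex_norm_square[of z] assms by (simp add: inverse_unique)
  then show ?thesis
    by (auto simp: unitary_power_def pow star_scaleC power_int_def)
qed

end

lemma star_endomorphism_unitary_power:
  assumes "star_endomorphism \<phi>"
  shows "\<phi> (unitary_power u m) = unitary_power (\<phi> u) m"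
proof -
  have "\<phi> (x ^ n) = \<phi> x ^ n" for x n
    using assms by (induction n) (simp_all add: star_hom_into_def)
  then show ?thesis using assms by (simp add: unitary_power_def star_hom_into_def)
qed

locale noncommutative_torus_algebra =
  fixes \<theta> :: real and U V :: "'a::cstar_algebra"
  assumes torus: "noncommutative_torus \<theta> U V"
begin

abbreviation phase :: complex where "phase \<equiv> exp (2 * pi * \<i> * \<theta>)"

abbreviation W :: "int \<times> int \<Rightarrow> 'a" where "W \<equiv> torus_monomial U V"

text \<open>The phase picked up when the power of \<open>V\<close> in \<open>W p\<close> moves past the power of \<open>U\<close> in
  \<open>W q\<close>.\<close>

definition cocycle :: "int \<times> int \<Rightarrow> int \<times> int \<Rightarrow> complex" where
  "cocycle p q = phase powi (- (fst q * snd p))"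

lemma norm_cocycle [simp]: "cmod (cocycle p q) = 1"
  by (simp add: cocycle_def norm_power_int)

lemma unitary_U: "star U * U = 1" "U * star U = 1"
  and unitary_V: "star V * V = 1" "V * star V = 1"
  and commutation: "U * V = scaleC phase (V * U)"
  using torus by (auto simp: noncommutative_torus_def torus_relations_def)

lemma unitary_power_commutation:
  "unitary_power V n * unitary_power U m
     = scaleC (phase powi (- (m * n))) (unitary_power U m * unitary_power V n)"
proof -
  have "scaleC (inverse phase) (U * V) = V * U"
    by (simp add: commutation)
  then have "V * unitary_power U m = scaleC (inverse phase powi m) (unitary_power U m * V)"
    by (intro unitary_power_commute_phase unitary_U) simp_all
  then have "scaleC (phase powi m) (V * unitary_power U m) = unitary_power U m * V"
    by (simp add: power_int_inverse)
  then have "unitary_power U m * unitary_power V n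
      = scaleC ((phase powi m) powi n) (unitary_power V n * unitary_power U m)"
    by (intro unitary_power_commute_phase unitary_V) simp_all
  then show ?thesis
    by (simp add: power_int_minus flip: power_int_mult)
qed

lemma monomial_mult: "W p * W q = scaleC (cocycle p q) (W (p + q))"
proof -
  obtain m n m' n' where pq: "p = (m, n)" "q = (m', n')" by (cases p, cases q)
  have "W p * W q
      = unitary_power U m * (unitary_power V n * unitary_power U m') * unitary_power V n'"
    by (simp add: pq torus_monomial_def mult.assoc)
  also have "\<dots> = scaleC (cocycle p q) (W (p + q))"
    by (simp add: unitary_power_commutation pq torus_monomial_def cocycle_def mult.assoc
        unitary_power_add[OF unitary_U] unitary_power_add[OF unitary_V])
  finally show ?thesis .
qed

lemma norm_monomial [simp]: "norm (W p) = 1"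
proof (rule norm_unitary)
  have "star (W p) * W p = star (unitary_power V (snd p)) *
      ((star (unitary_power U (fst p)) * unitary_power U (fst p)) * unitary_power V (snd p))"
    by (simp add: torus_monomial_def case_prod_unfold star_mult mult.assoc)
  then show "star (W p) * W p = 1"
    by (simp add: unitary_power_unitary[OF unitary_U] unitary_power_unitary[OF unitary_V])
qed

text \<open>Rescaling \<open>U\<close> and \<open>V\<close> by phases preserves the defining relations, so the universal property
  applies with the algebra itself as target. This is the gauge action of the 2-torus.\<close>

lemma gauge_endomorphism_exists:
  assumes "cmod z = 1" "cmod w = 1"
  obtains \<phi> where "star_endomorphism \<phi>"
    and "\<And>p. \<phi> (W p) = scaleC (z powi fst p * w powi snd p) (W p)"
proof -
  have unit: "cnj z * z = 1" "cnj w * w = 1"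
    using assms by (metis complex_norm_square mult.commute of_real_1 power_one)+
  have "torus_relations \<theta> scaleC (*) 1 star (scaleC z U) (scaleC w V)"
    using unit unitary_U unitary_V commutation
    by (simp add: torus_relations_def star_scaleC mult_ac)
  then obtain \<phi> where \<phi>: "star_endomorphism \<phi>" "\<phi> U = scaleC z U" "\<phi> V = scaleC w V"
    using torus[unfolded noncommutative_torus_def, THEN conjunct2, THEN conjunct2, rule_format,
        of UNIV "(+)" 0 scaleC "(*)" 1 star norm "scaleC z U" "scaleC w V"]
      unital_cstar_algebra_UNIV by auto
  have "\<phi> (W p) = scaleC (z powi fst p * w powi snd p) (W p)" for p
  proof -
    have "\<phi> (W p) = unitary_power (\<phi> U) (fst p) * unitary_power (\<phi> V) (snd p)"
      using \<phi>(1) star_endomorphism_unitary_power[OF \<phi>(1)]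
      by (simp add: torus_monomial_def case_prod_unfold star_hom_into_def)
    then show ?thesis
      by (simp add: \<phi> unitary_power_scaleC[OF unitary_U] unitary_power_scaleC[OF unitary_V]
          assms torus_monomial_def case_prod_unfold mult.commute)
  qed
  with \<phi>(1) show ?thesis by (rule that)
qed

end


section \<open>Uniqueness of Fourier coefficients\<close>

lemma sum_roots_of_unity_powi:
  fixes d :: int
  assumes "N > 0"
  shows "(\<Sum>j<N. (cis (2 * pi / N) ^ j) powi d) = (if int N dvd d then of_nat N else 0)"
proof -
  define y where "y = cis (2 * pi / N) powi d"
  have y: "y = cis (2 * pi * (d / N))"
    by (simp add: y_def cis_power_int mult_ac)
  have "y ^ N = cis (2 * pi * d)"
    using assms by (simp add: y Complex.DeMoivre mult_ac)
  then have yN: "y ^ N = 1" by (simp add: cis_multiple_2pi)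
  have "(cis (2 * pi / N) ^ j) powi d = y ^ j" for j
    unfolding y_def by (metis power_int_of_nat power_int_mult mult.commute)
  then have sum: "(\<Sum>j<N. (cis (2 * pi / N) ^ j) powi d) = (if y = 1 then of_nat N else 0)"
    by (simp add: sum_gp_strict yN)
  have "y = 1 \<longleftrightarrow> int N dvd d"
  proof
    assume "y = 1"
    then have "cos (2 * pi * (d / N)) = 1" by (simp add: y complex_eq_iff)
    then obtain k :: int where "2 * pi * (d / N) = 2 * pi * k"
      by (auto simp: cos_one_2pi_int mult_ac)
    then have "real_of_int d = real_of_int (int N * k)" using assms by (simp add: field_simps)
    then show "int N dvd d" by (simp only: of_int_eq_iff) simp
  next
    assume "int N dvd d"
    then obtain k where "d = int N * k" by (elim dvdE)
    then show "y = 1" using assms by (simp add: y cis_multiple_2pi)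
  qed
  with sum show ?thesis by simp
qed

context noncommutative_torus_algebra
begin

text \<open>A weighted sum of gauge endomorphisms that acts on monomials as the projection onto the
  indices congruent to \<open>q\<close> modulo \<open>N\<close>. It is bounded, so it may be applied termwise.\<close>

lemma roots_of_unity_average:
  assumes "N > 0"
    and sum: "((\<lambda>p. scaleC (c p) (W p)) has_sum 0) UNIV"
  shows "((\<lambda>p. scaleC (of_bool (int N dvd fst p - fst q \<and> int N dvd snd p - snd q) * c p) (W p))
           has_sum 0) UNIV"
proof -
  define z where "z = cis (2 * pi / N)"
  have norm_z: "cmod (z ^ j) = 1" for j by (simp add: z_def norm_power)
  have "\<exists>\<phi>. star_endomorphism \<phi> \<and>
      (\<forall>p. \<phi> (W p) = scaleC ((z ^ j) powi fst p * (z ^ k) powi snd p) (W p))" for j k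
    by (rule gauge_endomorphism_exists[OF norm_z[of j] norm_z[of k]]) blast
  then obtain \<phi> where \<phi>: "\<And>j k. star_endomorphism (\<phi> j k)"
    "\<And>j k p. \<phi> j k (W p) = scaleC ((z ^ j) powi fst p * (z ^ k) powi snd p) (W p)"
    by metis
  define E where "E x = (\<Sum>j<N. \<Sum>k<N. scaleC ((z ^ j) powi (- fst q) * (z ^ k) powi (- snd q) / N\<^sup>2)
      (\<phi> j k x))" for x
  have E: "bounded_linear E"
    unfolding E_def
    by (intro bounded_linear_sum bounded_linear_compose[OF bounded_linear_scaleC_right]
        star_endomorphism_bounded_linear \<phi>(1))
  have "E (scaleC (c p) (W p))
      = scaleC (of_bool (int N dvd fst p - fst q \<and> int N dvd snd p - snd q) * c p) (W p)" for p
  proof -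
    have nz: "z \<noteq> 0" by (simp add: z_def)
    have summand: "scaleC ((z ^ j) powi (- fst q) * (z ^ k) powi (- snd q) / N\<^sup>2) (\<phi> j k (scaleC (c p) (W p)))
        = scaleC ((z ^ j) powi (fst p - fst q) * (z ^ k) powi (snd p - snd q) * (c p / N\<^sup>2)) (W p)" for j k
    proof -
      have "\<phi> j k (scaleC (c p) (W p)) = scaleC (c p) (\<phi> j k (W p))"
        using \<phi>(1)[of j k] by (simp add: star_hom_into_def)
      then show ?thesis
        by (simp add: \<phi>(2) power_int_diff nz power_int_minus field_simps)
    qed
    have "E (scaleC (c p) (W p)) = scaleC (\<Sum>j<N. \<Sum>k<N.
        (z ^ j) powi (fst p - fst q) * (z ^ k) powi (snd p - snd q) * (c p / N\<^sup>2)) (W p)"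
      by (simp only: E_def summand bounded_linear.linear[OF bounded_linear_scaleC_left, THEN linear_sum])
    also have "(\<Sum>j<N. \<Sum>k<N. (z ^ j) powi (fst p - fst q) * (z ^ k) powi (snd p - snd q) * (c p / N\<^sup>2))
        = (\<Sum>j<N. (z ^ j) powi (fst p - fst q)) * (\<Sum>k<N. (z ^ k) powi (snd p - snd q)) * (c p / N\<^sup>2)"
      by (simp only: sum_product) (simp only: sum_distrib_right)
    also have "\<dots> = of_bool (int N dvd fst p - fst q \<and> int N dvd snd p - snd q) * c p"
      unfolding z_def sum_roots_of_unity_powi[OF assms(1)]
      using assms(1) by (simp add: power2_eq_square)
    finally show ?thesis .
  qed
  moreover have "E 0 = 0" using bounded_linear.linear[OF E] by (rule linear_0)
  ultimately show ?thesis using has_sum_bounded_linear[OF E sum] by simp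
qed

text \<open>Averaging over the gauge action of the \<open>N\<close>-th roots of unity kills all terms except those
  congruent to \<open>q\<close> modulo \<open>N\<close>. For large \<open>N\<close> the terms other than the one at \<open>q\<close> lie in the
  tail of an absolutely convergent series.\<close>

lemma fourier_coefficients_zero:
  assumes summable: "(\<lambda>p. cmod (c p)) summable_on UNIV"
    and sum: "((\<lambda>p. scaleC (c p) (W p)) has_sum 0) UNIV"
  shows "c q = 0"
proof -
  have "cmod (c q) \<le> e" if "e > 0" for e
  proof -
    obtain S where S: "((\<lambda>p. cmod (c p)) has_sum S) UNIV"
      using summable by (auto simp: summable_on_def)
    then have "eventually (\<lambda>F. dist (sum (\<lambda>p. cmod (c p)) F) S < e) (finite_subsets_at_top UNIV)"
      using \<open>e > 0\<close> by (auto simp: has_sum_def tendsto_iff)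
    then obtain F0 where F0: "finite F0"
      "\<And>F. finite F \<Longrightarrow> F0 \<subseteq> F \<Longrightarrow> dist (sum (\<lambda>p. cmod (c p)) F) S < e"
      by (auto simp: eventually_finite_subsets_at_top)
    define F where "F = insert q F0"
    have F: "finite F" "q \<in> F" "dist (sum (\<lambda>p. cmod (c p)) F) S < e"
      using F0 by (auto simp: F_def)
    \<comment> \<open>\<open>N\<close> exceeds all coordinate differences between \<open>q\<close> and points of \<open>F\<close>, so no other point
      of \<open>F\<close> is congruent to \<open>q\<close>.\<close>
    define N where "N = nat (1 + (\<Sum>p\<in>F. \<bar>fst p - fst q\<bar> + \<bar>snd p - snd q\<bar>))"
    have N: "int N = 1 + (\<Sum>p\<in>F. \<bar>fst p - fst q\<bar> + \<bar>snd p - snd q\<bar>)"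
      unfolding N_def by (intro int_nat_eq[THEN trans]) (simp add: sum_nonneg add_nonneg_nonneg)
    have isolated: "p = q" if "p \<in> F" "int N dvd fst p - fst q" "int N dvd snd p - snd q" for p
    proof -
      have "\<bar>fst p - fst q\<bar> + \<bar>snd p - snd q\<bar>
          \<le> (\<Sum>p\<in>F. \<bar>fst p - fst q\<bar> + \<bar>snd p - snd q\<bar>)"
        by (rule member_le_sum) (use that F in auto)
      then have "\<bar>fst p - fst q\<bar> < int N" "\<bar>snd p - snd q\<bar> < int N" using N by auto
      moreover have "d = 0" if "int N dvd d" "\<bar>d\<bar> < int N" for d
        using dvd_imp_le_int[OF _ that(1)] that(2) by force
      ultimately have "fst p - fst q = 0" "snd p - snd q = 0"
        using that(2,3) by blast+
      then show "p = q" by (simp add: prod_eq_iff)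
    qed
    define x where "x p = scaleC (of_bool (int N dvd fst p - fst q \<and> int N dvd snd p - snd q) * c p) (W p)"
      for p
    have "N > 0" unfolding N_def by (simp add: sum_nonneg add_pos_nonneg)
    then have "(x has_sum 0) UNIV"
      unfolding x_def using sum by (rule roots_of_unity_average)
    then have tail_x: "(x has_sum (0 - sum x F)) (UNIV - F)"
      by (intro has_sum_Diff has_sum_finite F) auto
    have tail_c: "((\<lambda>p. cmod (c p)) has_sum (S - sum (\<lambda>p. cmod (c p)) F)) (UNIV - F)"
      by (intro has_sum_Diff has_sum_finite F S) auto
    have "sum x F = (\<Sum>p\<in>F. if p = q then scaleC (c q) (W q) else 0)"
      by (rule sum.cong) (auto simp: x_def dest: isolated)
    also have "\<dots> = scaleC (c q) (W q)" using F by simp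
    finally have "cmod (c q) = norm (0 - sum x F)" by simp
    also have "\<dots> \<le> S - sum (\<lambda>p. cmod (c p)) F"
      by (rule norm_infsum_le[OF tail_x tail_c]) (simp add: x_def)
    also have "\<dots> \<le> e" using F(3) by (simp add: dist_real_def)
    finally show ?thesis .
  qed
  then have "cmod (c q) \<le> 0" by (rule field_le_epsilon[of _ 0, simplified])
  then show ?thesis by simp
qed

end

section \<open>Rapidly decreasing double sequences\<close>

lemma summable_on_product_nonneg:
  fixes f :: "'b \<Rightarrow> real" and g :: "'c \<Rightarrow> real"
  assumes "f summable_on UNIV" "g summable_on UNIV" "\<And>x. f x \<ge> 0" "\<And>y. g y \<ge> 0"
  shows "(\<lambda>(x, y). f x * g y) summable_on UNIV"
proof -
  have "((\<lambda>y. f x * g y) has_sum (f x * infsum g UNIV)) UNIV" for x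
    by (intro has_sum_cmult_right has_sum_infsum assms)
  moreover have "(\<lambda>x. f x * infsum g UNIV) summable_on UNIV"
    by (intro summable_on_cmult_left assms)
  ultimately have "(\<lambda>(x, y). f x * g y) summable_on (UNIV \<times> UNIV)"
    by (intro summable_on_SigmaI[where g = "\<lambda>x. f x * infsum g UNIV"]) (auto simp: assms)
  then show ?thesis by simp
qed

lemma inverse_squares_summable_int:
  "(\<lambda>m::int. 1 / (1 + \<bar>real_of_int m\<bar>)\<^sup>2) summable_on UNIV"
proof -
  have half: "(\<lambda>n::nat. 1 / (1 + real n)\<^sup>2) summable_on UNIV"
  proof (rule norm_summable_imp_summable_on)
    have "summable (\<lambda>n. 1 / real (Suc n) ^ 2)"
      using inverse_power_summable[of 2, where 'a = real]
      by (subst summable_Suc_iff) (simp add: field_simps)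
    then show "summable (\<lambda>n::nat. norm (1 / (1 + real n)\<^sup>2))" by (simp add: add_ac)
  qed
  have "(\<lambda>m::int. 1 / (1 + \<bar>real_of_int m\<bar>)\<^sup>2) summable_on range int"
    by (subst summable_on_reindex) (simp_all add: o_def half)
  moreover have "(\<lambda>m::int. 1 / (1 + \<bar>real_of_int m\<bar>)\<^sup>2) summable_on range (\<lambda>n. - 1 - int n)"
  proof (subst summable_on_reindex)
    have "(\<lambda>n::nat. 1 / (2 + real n)\<^sup>2) summable_on UNIV"
      by (rule summable_on_comparison_test[OF half]) (auto intro!: divide_left_mono power_mono)
    then show "((\<lambda>m::int. 1 / (1 + \<bar>real_of_int m\<bar>)\<^sup>2) \<circ> (\<lambda>n. - 1 - int n)) summable_on UNIV"
      by (simp add: o_def abs_if algebra_simps)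
  qed (auto simp: inj_on_def)
  moreover have "(UNIV :: int set) = range int \<union> range (\<lambda>n. - 1 - int n)"
  proof (intro equalityI subsetI)
    fix m :: int
    show "m \<in> range int \<union> range (\<lambda>n. - 1 - int n)"
    proof (cases "0 \<le> m")
      case True
      then show ?thesis by (metis UnI1 nonneg_int_cases rangeI)
    next
      case False
      then have "m = - 1 - int (nat (- 1 - m))" by simp
      then show ?thesis by blast
    qed
  qed simp
  moreover have "range int \<inter> range (\<lambda>n. - 1 - int n) = {}" by auto
  ultimately show ?thesis by (metis summable_on_Un_disjoint)
qed

text \<open>The weight used to measure decay. The summand 1 makes it submultiplicative.\<close>

definition lattice_size :: "int \<times> int \<Rightarrow> real" where
  "lattice_size p = 1 + \<bar>real_of_int (fst p)\<bar> + \<bar>real_of_int (snd p)\<bar>"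

lemma lattice_size_ge_1: "lattice_size p \<ge> 1"
  by (simp add: lattice_size_def)

lemma lattice_size_pow_ge_1: "lattice_size p ^ k \<ge> 1"
  by (simp add: lattice_size_ge_1)

lemma lattice_size_mult: "lattice_size (p + q) \<le> lattice_size p * lattice_size q"
proof -
  have "lattice_size (p + q) \<le> lattice_size p + lattice_size q - 1"
    by (simp add: lattice_size_def)
  also have "\<dots> \<le> lattice_size p * lattice_size q"
    using mult_nonneg_nonneg[of "lattice_size p - 1" "lattice_size q - 1"] lattice_size_ge_1[of p]
      lattice_size_ge_1[of q] by (simp add: algebra_simps)
  finally show ?thesis .
qed

lemma rapidly_decreasing_iff:
  "rapidly_decreasing c \<longleftrightarrow> (\<forall>k. \<exists>C. \<forall>p. lattice_size p ^ k * cmod (c p) \<le> C)"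
  by (simp add: rapidly_decreasing_def lattice_size_def)

lemma rapidly_decreasing_bound:
  assumes "rapidly_decreasing c"
  obtains C where "C \<ge> 0" "\<And>p. lattice_size p ^ k * cmod (c p) \<le> C"
proof -
  obtain C where C: "\<And>p. lattice_size p ^ k * cmod (c p) \<le> C"
    using assms rapidly_decreasing_iff by blast
  moreover have "0 \<le> C"
    by (rule order_trans[OF _ C[of 0]]) (simp add: lattice_size_def)
  ultimately show ?thesis using that by blast
qed

text \<open>Four additional powers of the weight dominate
  \<open>(1 + \<bar>m\<bar>)\<^sup>2 (1 + \<bar>n\<bar>)\<^sup>2\<close>, whose reciprocal is summable over the lattice.\<close>

lemma rapidly_decreasing_weighted_summable:
  assumes "rapidly_decreasing c"
  shows "(\<lambda>p. lattice_size p ^ k * cmod (c p)) summable_on UNIV"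
proof -
  obtain C where C: "C \<ge> 0" "\<And>p. lattice_size p ^ (k + 4) * cmod (c p) \<le> C"
    using rapidly_decreasing_bound[OF assms] by blast
  define h where "h m = 1 / (1 + \<bar>real_of_int m\<bar>)\<^sup>2" for m
  have h: "h summable_on UNIV"
    using inverse_squares_summable_int by (simp add: h_def[abs_def])
  have "(\<lambda>p. C * (h (fst p) * h (snd p))) summable_on UNIV"
    using summable_on_product_nonneg[OF h h]
    by (intro summable_on_cmult_right) (simp add: h_def case_prod_unfold)
  then show ?thesis
  proof (rule summable_on_comparison_test)
    fix p
    have "(1 + \<bar>real_of_int (fst p)\<bar>)\<^sup>2 * (1 + \<bar>real_of_int (snd p)\<bar>)\<^sup>2
        \<le> lattice_size p ^ 2 * lattice_size p ^ 2"
      unfolding lattice_size_def by (intro mult_mono power_mono) auto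
    then have 4: "(1 + \<bar>real_of_int (fst p)\<bar>)\<^sup>2 * (1 + \<bar>real_of_int (snd p)\<bar>)\<^sup>2
        \<le> lattice_size p ^ 4" by (simp flip: power_add)
    have nn: "0 \<le> lattice_size p ^ k * cmod (c p)"
      by (intro mult_nonneg_nonneg order_trans[OF _ lattice_size_pow_ge_1]) auto
    have "((1 + \<bar>real_of_int (fst p)\<bar>)\<^sup>2 * (1 + \<bar>real_of_int (snd p)\<bar>)\<^sup>2) *
        (lattice_size p ^ k * cmod (c p)) \<le> C"
      using mult_right_mono[OF 4 nn] C(2)[of p] by (simp add: power_add mult_ac)
    then have "lattice_size p ^ k * cmod (c p)
        \<le> C / ((1 + \<bar>real_of_int (fst p)\<bar>)\<^sup>2 * (1 + \<bar>real_of_int (snd p)\<bar>)\<^sup>2)"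
      by (subst pos_le_divide_eq) (auto simp: mult_ac intro!: mult_pos_pos zero_less_power)
    then show "lattice_size p ^ k * cmod (c p) \<le> C * (h (fst p) * h (snd p))"
      by (simp add: h_def)
  qed (auto intro!: mult_nonneg_nonneg order_trans[OF _ lattice_size_pow_ge_1])
qed

lemma rapidly_decreasing_summable:
  "rapidly_decreasing c \<Longrightarrow> (\<lambda>p. cmod (c p)) summable_on UNIV"
  using rapidly_decreasing_weighted_summable[of c 0] by simp

lemma rapidly_decreasing_add:
  assumes "rapidly_decreasing c" "rapidly_decreasing d"
  shows "rapidly_decreasing (\<lambda>p. c p + d p)"
  unfolding rapidly_decreasing_iff
proof
  fix k
  obtain C D where "\<And>p. lattice_size p ^ k * cmod (c p) \<le> C" "\<And>p. lattice_size p ^ k * cmod (d p) \<le> D"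
    using assms rapidly_decreasing_iff by metis
  moreover have "lattice_size p ^ k * cmod (c p + d p)
      \<le> lattice_size p ^ k * cmod (c p) + lattice_size p ^ k * cmod (d p)" for p
    unfolding distrib_left[symmetric] using lattice_size_pow_ge_1[of p k]
    by (intro mult_left_mono norm_triangle_ineq) auto
  ultimately show "\<exists>C. \<forall>p. lattice_size p ^ k * cmod (c p + d p) \<le> C"
    by (meson add_mono order_trans)
qed

lemma rapidly_decreasing_mult_polynomial:
  assumes "rapidly_decreasing c" and growth: "\<And>p. cmod (w p) \<le> K * lattice_size p"
  shows "rapidly_decreasing (\<lambda>p. w p * c p)"
  unfolding rapidly_decreasing_iff
proof
  fix k
  obtain C where C: "\<And>p. lattice_size p ^ Suc k * cmod (c p) \<le> C"
    using assms rapidly_decreasing_iff by metis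
  have "0 \<le> K" using order_trans[OF norm_ge_zero growth[of 0]] by (simp add: lattice_size_def)
  have "lattice_size p ^ k * cmod (w p * c p) \<le> K * C" for p
  proof -
    have "lattice_size p ^ k * cmod (w p * c p) \<le> lattice_size p ^ k * ((K * lattice_size p) * cmod (c p))"
      unfolding norm_mult using lattice_size_pow_ge_1[of p k]
      by (intro mult_left_mono mult_right_mono growth) auto
    also have "\<dots> = K * (lattice_size p ^ Suc k * cmod (c p))" by simp
    also have "\<dots> \<le> K * C" by (intro mult_left_mono C \<open>0 \<le> K\<close>)
    finally show ?thesis .
  qed
  then show "\<exists>C. \<forall>p. lattice_size p ^ k * cmod (w p * c p) \<le> C" by blast
qed

lemma rapidly_decreasing_cmult:
  assumes "rapidly_decreasing c"
  shows "rapidly_decreasing (\<lambda>p. a * c p)"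
proof (rule rapidly_decreasing_mult_polynomial[OF assms])
  show "cmod a \<le> cmod a * lattice_size p" for p
    using mult_left_mono[OF lattice_size_ge_1[of p], of "cmod a"] by simp
qed


section \<open>The smooth subalgebra, its trace and its derivations\<close>

context noncommutative_torus_algebra
begin

abbreviation "expansion \<equiv> has_torus_expansion U V"
abbreviation "smooth \<equiv> smooth_torus U V"
abbreviation "fourier \<equiv> torus_coeff U V"
abbreviation "\<tau> \<equiv> torus_trace U V"
abbreviation "\<delta> \<equiv> torus_deriv U V"

lemma expansion_unique:
  assumes "expansion c a" "expansion d a"
  shows "c = d"
proof
  fix p
  have rd: "rapidly_decreasing (\<lambda>p. c p + (- 1) * d p)"
    using assms unfolding has_torus_expansion_def
    by (intro rapidly_decreasing_add rapidly_decreasing_cmult) auto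
  have "((\<lambda>p. scaleC (c p) (W p) + scaleC (- 1) (scaleC (d p) (W p))) has_sum (a + scaleC (- 1) a)) UNIV"
    using assms unfolding has_torus_expansion_def
    by (intro has_sum_add has_sum_bounded_linear[OF bounded_linear_scaleC_right]) auto
  then have "((\<lambda>p. scaleC (c p + (- 1) * d p) (W p)) has_sum 0) UNIV"
    by (simp only: scaleC_scaleC scaleC_add_left[symmetric]) (simp add: scaleC_minus_left)
  from fourier_coefficients_zero[OF rapidly_decreasing_summable[OF rd] this]
  show "c p = d p" by simp
qed

lemma fourier_eq:
  assumes "expansion c a"
  shows "fourier a = c"
  unfolding torus_coeff_def using assms expansion_unique[OF _ assms] by (rule the_equality)

lemma expansion_fourier: "a \<in> smooth \<Longrightarrow> expansion (fourier a) a"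
  using fourier_eq unfolding smooth_torus_def by fastforce

lemma expansion_smooth: "expansion c a \<Longrightarrow> a \<in> smooth"
  unfolding smooth_torus_def by blast

lemma trace_eq: "expansion c a \<Longrightarrow> \<tau> a = c 0"
  by (simp add: torus_trace_def fourier_eq zero_prod_def)

lemma expansion_exists:
  assumes "rapidly_decreasing c"
  shows "expansion c (\<Sum>\<^sub>\<infinity>p. scaleC (c p) (W p))"
proof -
  have "(\<lambda>p. norm (scaleC (c p) (W p))) summable_on UNIV"
    using rapidly_decreasing_summable[OF assms] by simp
  then have "(\<lambda>p. scaleC (c p) (W p)) summable_on UNIV"
    by (rule abs_summable_summable)
  then show ?thesis
    using assms by (simp add: has_torus_expansion_def has_sum_infsum)
qed

lemma expansion_add:
  assumes "expansion c a" "expansion d b"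
  shows "expansion (\<lambda>p. c p + d p) (a + b)"
  using assms unfolding has_torus_expansion_def
  by (simp add: scaleC_add_left has_sum_add rapidly_decreasing_add)

lemma expansion_scaleC:
  assumes "expansion c a"
  shows "expansion (\<lambda>p. x * c p) (scaleC x a)"
proof -
  have "((\<lambda>p. scaleC x (scaleC (c p) (W p))) has_sum scaleC x a) UNIV"
    using assms unfolding has_torus_expansion_def
    by (intro has_sum_bounded_linear[OF bounded_linear_scaleC_right]) auto
  then show ?thesis
    using assms by (simp add: has_torus_expansion_def rapidly_decreasing_cmult)
qed

lemma expansion_one: "expansion (\<lambda>p. of_bool (p = 0)) 1"
  unfolding has_torus_expansion_def
proof
  show "rapidly_decreasing (\<lambda>p. of_bool (p = 0))"
    unfolding rapidly_decreasing_iff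
  proof (intro allI exI)
    fix k p show "lattice_size p ^ k * cmod (of_bool (p = 0)) \<le> 1"
      by (simp add: lattice_size_def)
  qed
  have "((\<lambda>p. scaleC (of_bool (p = 0)) (W p)) has_sum 1) {0}"
    by (rule has_sum_finiteI) (simp_all add: torus_monomial_def unitary_power_def zero_prod_def)
  then show "((\<lambda>p. scaleC (of_bool (p = 0)) (W p)) has_sum 1) UNIV"
    by (rule has_sum_cong_neutral[THEN iffD1, rotated -1]) auto
qed

text \<open>The coefficient sequence of a product: convolution on the lattice, twisted by the
  commutation phases.\<close>

definition twisted_convolution ::
  "(int \<times> int \<Rightarrow> complex) \<Rightarrow> (int \<times> int \<Rightarrow> complex) \<Rightarrow> int \<times> int \<Rightarrow> complex" where
  "twisted_convolution c d r = (\<Sum>\<^sub>\<infinity>p. c p * d (r - p) * cocycle p (r - p))"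

lemma twisted_convolution_summable:
  assumes "rapidly_decreasing c" "rapidly_decreasing d"
  shows "(\<lambda>p. c p * d (r - p) * cocycle p (r - p)) summable_on UNIV"
proof -
  obtain D where "D \<ge> 0" and D: "\<And>p. cmod (d p) \<le> D"
    using rapidly_decreasing_bound[OF assms(2), of 0] by auto
  have "(\<lambda>p. D * cmod (c p)) summable_on UNIV"
    by (intro summable_on_cmult_right rapidly_decreasing_summable assms)
  then have "(\<lambda>p. norm (c p * d (r - p) * cocycle p (r - p))) summable_on UNIV"
  proof (rule summable_on_comparison_test)
    show "norm (c p * d (r - p) * cocycle p (r - p)) \<le> D * cmod (c p)" for p
      using mult_right_mono[OF D[of "r - p"], of "cmod (c p)"] by (simp add: norm_mult mult.commute)
  qed simp
  then show ?thesis by (rule abs_summable_summable)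
qed

text \<open>Submultiplicativity distributes the weight at \<open>r\<close> over the indices \<open>p\<close> and \<open>r - p\<close>: one
  factor stays summable and the other one bounded.\<close>

lemma rapidly_decreasing_twisted_convolution:
  assumes "rapidly_decreasing c" "rapidly_decreasing d"
  shows "rapidly_decreasing (twisted_convolution c d)"
  unfolding rapidly_decreasing_iff
proof
  fix k
  obtain D where "D \<ge> 0" and D: "\<And>p. lattice_size p ^ k * cmod (d p) \<le> D"
    using rapidly_decreasing_bound[OF assms(2), of k] by blast
  have "lattice_size r ^ k * cmod (twisted_convolution c d r)
      \<le> (\<Sum>\<^sub>\<infinity>p. D * (lattice_size p ^ k * cmod (c p)))" for r
  proof -
    have "norm (of_real (lattice_size r ^ k) * twisted_convolution c d r)
        \<le> (\<Sum>\<^sub>\<infinity>p. D * (lattice_size p ^ k * cmod (c p)))"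
    proof (rule norm_infsum_le)
      show "((\<lambda>p. of_real (lattice_size r ^ k) * (c p * d (r - p) * cocycle p (r - p)))
          has_sum of_real (lattice_size r ^ k) * twisted_convolution c d r) UNIV"
        unfolding twisted_convolution_def
        by (intro has_sum_cmult_right has_sum_infsum twisted_convolution_summable assms)
      show "((\<lambda>p. D * (lattice_size p ^ k * cmod (c p)))
          has_sum (\<Sum>\<^sub>\<infinity>p. D * (lattice_size p ^ k * cmod (c p)))) UNIV"
        by (intro has_sum_infsum summable_on_cmult_right
            rapidly_decreasing_weighted_summable assms)
      fix p
      have pos: "0 \<le> lattice_size x" for x using lattice_size_ge_1[of x] by simp
      have "lattice_size r ^ k \<le> (lattice_size p * lattice_size (r - p)) ^ k"
        using lattice_size_mult[of p "r - p"] pos by (intro power_mono) auto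
      then have "lattice_size r ^ k * (cmod (c p) * cmod (d (r - p)))
          \<le> (lattice_size p * lattice_size (r - p)) ^ k * (cmod (c p) * cmod (d (r - p)))"
        by (intro mult_right_mono) auto
      also have "\<dots> = (lattice_size (r - p) ^ k * cmod (d (r - p))) * (lattice_size p ^ k * cmod (c p))"
        by (simp add: power_mult_distrib)
      also have "\<dots> \<le> D * (lattice_size p ^ k * cmod (c p))"
        using pos by (intro mult_right_mono D) auto
      finally show "norm (of_real (lattice_size r ^ k) * (c p * d (r - p) * cocycle p (r - p)))
          \<le> D * (lattice_size p ^ k * cmod (c p))"
        using pos[of r] by (simp add: norm_mult norm_power)
    qed
    then show ?thesis
      using lattice_size_ge_1[of r] by (simp add: norm_mult norm_power)
  qed
  then show "\<exists>C. \<forall>r. lattice_size r ^ k * cmod (twisted_convolution c d r) \<le> C" by blast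
qed

text \<open>The double series of products of terms converges absolutely, so it may be regrouped along
  the antidiagonals \<open>p + q = r\<close>, on which all monomials are multiples of \<open>W r\<close>.\<close>

lemma expansion_mult:
  assumes "expansion c a" "expansion d b"
  shows "expansion (twisted_convolution c d) (a * b)"
proof -
  have c: "rapidly_decreasing c" "((\<lambda>p. scaleC (c p) (W p)) has_sum a) UNIV"
    and d: "rapidly_decreasing d" "((\<lambda>p. scaleC (d p) (W p)) has_sum b) UNIV"
    using assms by (auto simp: has_torus_expansion_def)
  define f where "f = (\<lambda>(p, q). scaleC (c p) (W p) * scaleC (d q) (W q))"
  have f: "f (p, q) = scaleC (c p * d q * cocycle p q) (W (p + q))" for p q
    by (simp add: f_def monomial_mult mult_ac)
  have norm_f: "norm (f x) = cmod (c (fst x)) * cmod (d (snd x))" for x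
    by (cases x) (simp add: f norm_mult)
  have "(\<lambda>x. norm (f x)) summable_on UNIV"
    using summable_on_product_nonneg[OF c(1)[THEN rapidly_decreasing_summable]
        d(1)[THEN rapidly_decreasing_summable]]
    by (simp add: norm_f case_prod_unfold)
  then have "f summable_on UNIV \<times> UNIV" by (simp add: abs_summable_summable)
  then have "(f has_sum a * b) (UNIV \<times> UNIV)"
  proof (rule has_sum_SigmaI[rotated 2])
    show "((\<lambda>q. f (p, q)) has_sum scaleC (c p) (W p) * b) UNIV" for p
      unfolding f_def prod.case by (rule has_sum_bounded_linear[OF bounded_linear_mult_right d(2)])
    show "((\<lambda>p. scaleC (c p) (W p) * b) has_sum a * b) UNIV"
      by (rule has_sum_bounded_linear[OF bounded_linear_mult_left c(2)])
  qed
  then have "((\<lambda>(r, p). f (p, r - p)) has_sum a * b) (UNIV \<times> UNIV)"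
    by (rule has_sum_reindex_bij_witness[where i = "\<lambda>(r, p). (p, r - p)" and j = "\<lambda>(p, q). (p + q, p)",
          THEN iffD1, rotated -1]) auto
  then have "((\<lambda>r. scaleC (twisted_convolution c d r) (W r)) has_sum a * b) UNIV"
  proof (rule has_sum_SigmaD)
    fix r
    have "((\<lambda>p. scaleC (c p * d (r - p) * cocycle p (r - p)) (W r)) has_sum
        scaleC (twisted_convolution c d r) (W r)) UNIV"
      unfolding twisted_convolution_def
      by (intro has_sum_bounded_linear[OF bounded_linear_scaleC_left] has_sum_infsum
          twisted_convolution_summable c d)
    then show "((\<lambda>p. case (r, p) of (r, p) \<Rightarrow> f (p, r - p)) has_sum
        scaleC (twisted_convolution c d r) (W r)) UNIV"
      by (simp add: f)
  qed
  then show ?thesis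
    using rapidly_decreasing_twisted_convolution[OF c(1) d(1)] by (simp add: has_torus_expansion_def)
qed

definition deriv_weight :: "2 \<Rightarrow> int \<times> int \<Rightarrow> complex" where
  "deriv_weight i p = 2 * pi * \<i> * of_int (if i = 1 then fst p else snd p)"

lemma deriv_weight_add: "deriv_weight i (p + q) = deriv_weight i p + deriv_weight i q"
  by (simp add: deriv_weight_def algebra_simps)

lemma rapidly_decreasing_deriv:
  assumes "rapidly_decreasing c"
  shows "rapidly_decreasing (\<lambda>p. deriv_weight i p * c p)"
proof (rule rapidly_decreasing_mult_polynomial[OF assms])
  show "cmod (deriv_weight i p) \<le> 2 * pi * lattice_size p" for p
    by (simp add: deriv_weight_def lattice_size_def norm_mult)
qed

lemma expansion_deriv:
  assumes "expansion c a"
  shows "expansion (\<lambda>p. deriv_weight i p * c p) (\<delta> i a)"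
proof -
  have "\<delta> i a = (\<Sum>\<^sub>\<infinity>p. scaleC (deriv_weight i p * c p) (W p))"
    unfolding torus_deriv_def deriv_weight_def fourier_eq[OF assms] ..
  then show ?thesis
    using assms expansion_exists[OF rapidly_decreasing_deriv]
    by (auto simp: has_torus_expansion_def)
qed

lemma smooth_add: "a \<in> smooth \<Longrightarrow> b \<in> smooth \<Longrightarrow> a + b \<in> smooth"
  by (rule expansion_smooth[OF expansion_add[OF expansion_fourier expansion_fourier]])

lemma smooth_scaleC: "a \<in> smooth \<Longrightarrow> scaleC c a \<in> smooth"
  by (rule expansion_smooth[OF expansion_scaleC[OF expansion_fourier]])

lemma smooth_scaleR: "a \<in> smooth \<Longrightarrow> r *\<^sub>R a \<in> smooth"
  by (simp add: scaleR_scaleC smooth_scaleC)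

lemma smooth_diff: "a \<in> smooth \<Longrightarrow> b \<in> smooth \<Longrightarrow> a - b \<in> smooth"
  using smooth_add[of a "(- 1) *\<^sub>R b"] smooth_scaleR[of b "- 1"] by simp

lemma smooth_minus: "a \<in> smooth \<Longrightarrow> - a \<in> smooth"
  using smooth_scaleR[of a "- 1"] by simp

lemma smooth_one: "1 \<in> smooth"
  by (rule expansion_smooth[OF expansion_one])

lemma smooth_zero: "0 \<in> smooth"
  using smooth_scaleR[OF smooth_one, of 0] by simp

lemma smooth_of_real: "of_real r \<in> smooth"
  unfolding of_real_def by (intro smooth_scaleR smooth_one)

lemma smooth_mult: "a \<in> smooth \<Longrightarrow> b \<in> smooth \<Longrightarrow> a * b \<in> smooth"
  by (rule expansion_smooth[OF expansion_mult[OF expansion_fourier expansion_fourier]])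

lemma smooth_deriv: "a \<in> smooth \<Longrightarrow> \<delta> i a \<in> smooth"
  by (rule expansion_smooth[OF expansion_deriv[OF expansion_fourier]])

lemmas smooth_intros = smooth_add smooth_scaleR smooth_diff smooth_minus smooth_one smooth_zero
  smooth_of_real smooth_mult smooth_deriv

lemma trace_add: "a \<in> smooth \<Longrightarrow> b \<in> smooth \<Longrightarrow> \<tau> (a + b) = \<tau> a + \<tau> b"
  using trace_eq[OF expansion_add[OF expansion_fourier[of a] expansion_fourier[of b]]]
  by (simp add: trace_eq[OF expansion_fourier])

lemma trace_scaleR: "a \<in> smooth \<Longrightarrow> \<tau> (r *\<^sub>R a) = r * \<tau> a"
  using trace_eq[OF expansion_scaleC[OF expansion_fourier[of a], of "of_real r"]]
  by (simp add: trace_eq[OF expansion_fourier] scaleR_scaleC)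

lemma trace_minus: "a \<in> smooth \<Longrightarrow> \<tau> (- a) = - \<tau> a"
  using trace_scaleR[of a "- 1"] by simp

lemma trace_diff: "a \<in> smooth \<Longrightarrow> b \<in> smooth \<Longrightarrow> \<tau> (a - b) = \<tau> a - \<tau> b"
  using trace_add[of a "- b"] by (simp add: trace_minus smooth_minus)

text \<open>The coefficient of \<open>a * b\<close> at the origin pairs \<open>p\<close> with \<open>- p\<close>, and
  \<open>W p\<close> commutes with \<open>W (- p)\<close>.\<close>

lemma trace_commute:
  assumes "a \<in> smooth" "b \<in> smooth"
  shows "\<tau> (a * b) = \<tau> (b * a)"
proof -
  note ab = assms[THEN expansion_fourier]
  have "twisted_convolution (fourier a) (fourier b) 0 = twisted_convolution (fourier b) (fourier a) 0"
    unfolding twisted_convolution_def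
    by (rule infsum_reindex_bij_witness[where i = uminus and j = uminus])
       (simp_all add: cocycle_def)
  then show ?thesis
    by (simp add: trace_eq[OF expansion_mult[OF ab]] trace_eq[OF expansion_mult[OF ab(2,1)]])
qed

lemma trace_deriv: "a \<in> smooth \<Longrightarrow> \<tau> (\<delta> i a) = 0"
  by (drule expansion_fourier, drule expansion_deriv[of _ _ i])
     (simp add: trace_eq deriv_weight_def)

lemma deriv_add:
  assumes "a \<in> smooth" "b \<in> smooth"
  shows "\<delta> i (a + b) = \<delta> i a + \<delta> i b"
proof -
  note ab = assms[THEN expansion_fourier]
  have "expansion (\<lambda>p. deriv_weight i p * (fourier a p + fourier b p)) (\<delta> i (a + b))"
    by (intro expansion_deriv expansion_add ab)
  moreover have "expansion (\<lambda>p. deriv_weight i p * fourier a p + deriv_weight i p * fourier b p)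
      (\<delta> i a + \<delta> i b)"
    by (intro expansion_deriv expansion_add ab)
  ultimately show ?thesis
    unfolding distrib_left has_torus_expansion_def using has_sum_unique by blast
qed

lemma deriv_scaleR:
  assumes "a \<in> smooth"
  shows "\<delta> i (r *\<^sub>R a) = r *\<^sub>R \<delta> i a"
proof -
  note a = assms[THEN expansion_fourier]
  have "expansion (\<lambda>p. deriv_weight i p * (of_real r * fourier a p)) (\<delta> i (scaleC r a))"
    by (intro expansion_deriv expansion_scaleC a)
  moreover have "expansion (\<lambda>p. of_real r * (deriv_weight i p * fourier a p)) (scaleC r (\<delta> i a))"
    by (intro expansion_deriv expansion_scaleC a)
  ultimately show ?thesis
    unfolding mult.left_commute[of "of_real r"] has_torus_expansion_def scaleR_scaleC
    using has_sum_unique by blast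
qed

text \<open>The weights \<open>deriv_weight\<close> are additive, and the twisted convolution at \<open>r\<close> pairs the indices
  \<open>p\<close> and \<open>r - p\<close>.\<close>

lemma deriv_mult:
  assumes "a \<in> smooth" "b \<in> smooth"
  shows "\<delta> i (a * b) = \<delta> i a * b + a * \<delta> i b"
proof -
  note ab = assms[THEN expansion_fourier]
  have rd: "rapidly_decreasing (fourier a)" "rapidly_decreasing (fourier b)"
    using ab by (auto simp: has_torus_expansion_def)
  let ?D = "\<lambda>c p. deriv_weight i p * c p"
  have "twisted_convolution (?D (fourier a)) (fourier b) r + twisted_convolution (fourier a) (?D (fourier b)) r
      = ?D (twisted_convolution (fourier a) (fourier b)) r" for r
  proof -
    have "twisted_convolution (?D (fourier a)) (fourier b) r + twisted_convolution (fourier a) (?D (fourier b)) r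
        = (\<Sum>\<^sub>\<infinity>p. ?D (fourier a) p * fourier b (r - p) * cocycle p (r - p)
             + fourier a p * ?D (fourier b) (r - p) * cocycle p (r - p))"
      unfolding twisted_convolution_def
      by (intro infsum_add[symmetric] twisted_convolution_summable rapidly_decreasing_deriv rd)
    also have "\<dots> = (\<Sum>\<^sub>\<infinity>p. deriv_weight i r * (fourier a p * fourier b (r - p) * cocycle p (r - p)))"
    proof (rule infsum_cong)
      fix p
      have "deriv_weight i r = deriv_weight i p + deriv_weight i (r - p)"
        by (simp flip: deriv_weight_add)
      then show "?D (fourier a) p * fourier b (r - p) * cocycle p (r - p)
             + fourier a p * ?D (fourier b) (r - p) * cocycle p (r - p)
           = deriv_weight i r * (fourier a p * fourier b (r - p) * cocycle p (r - p))"
        by (simp add: algebra_simps)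
    qed
    also have "\<dots> = ?D (twisted_convolution (fourier a) (fourier b)) r"
      unfolding twisted_convolution_def
      by (intro infsum_cmult_right twisted_convolution_summable rd)
    finally show ?thesis .
  qed
  moreover have "expansion (\<lambda>r. twisted_convolution (?D (fourier a)) (fourier b) r
      + twisted_convolution (fourier a) (?D (fourier b)) r) (\<delta> i a * b + a * \<delta> i b)"
    by (intro expansion_add expansion_mult expansion_deriv ab)
  moreover have "expansion (?D (twisted_convolution (fourier a) (fourier b))) (\<delta> i (a * b))"
    by (intro expansion_deriv expansion_mult ab)
  ultimately show ?thesis
    unfolding has_torus_expansion_def using has_sum_unique by auto
qed

lemma deriv_one: "\<delta> i 1 = 0"
  using deriv_mult[OF smooth_one smooth_one, of i] by simp

lemma deriv_of_real: "\<delta> i (of_real r) = 0"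
  unfolding of_real_def deriv_scaleR[OF smooth_one] deriv_one by simp

lemma deriv_inverse:
  assumes "a \<in> smooth" "b \<in> smooth" "a * b = 1" "b * a = 1"
  shows "\<delta> i b = - (b * \<delta> i a * b)"
proof -
  have "\<delta> i a * b + a * \<delta> i b = 0"
    using deriv_mult[OF assms(1,2), of i] by (simp add: assms(3) deriv_one)
  then have "b * (\<delta> i a * b + a * \<delta> i b) = 0" by simp
  then have "b * \<delta> i a * b + (b * a) * \<delta> i b = 0"
    by (simp only: distrib_left mult.assoc)
  then show ?thesis by (simp add: assms(4) eq_neg_iff_add_eq_0 add.commute)
qed

end


section \<open>Levi-Civita connection and curvature\<close>

lemma of_real_mult_eq_scaleR: "of_real r * x = r *\<^sub>R (x :: 'a::real_algebra_1)"
  unfolding of_real_def by simp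

lemma mult_of_real_eq_scaleR: "x * of_real r = r *\<^sub>R (x :: 'a::real_algebra_1)"
  unfolding of_real_def by simp

lemma matrix_inv_eqI:
  fixes A B :: "'a::semiring_1 ^ 'n ^ 'n"
  assumes "A ** B = mat 1" "B ** A = mat 1"
  shows "matrix_inv A = B"
proof -
  have "A ** matrix_inv A = mat 1 \<and> matrix_inv A ** A = mat 1"
    unfolding matrix_inv_def by (rule someI_ex) (use assms in blast)
  then show ?thesis
    by (metis assms(2) matrix_mul_assoc matrix_mul_lid matrix_mul_rid)
qed

locale torus_levi_civita = noncommutative_torus_algebra \<theta> U V
  for \<theta> :: real and U V :: "'a::cstar_algebra" +
  fixes G :: "'a ^ 2 \<Rightarrow> 'a ^ 2 \<Rightarrow> 'a" and D :: "2 \<Rightarrow> 'a ^ 2 \<Rightarrow> 'a ^ 2"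
  assumes metric: "riemannian_metric U V G"
    and connection: "levi_civita_connection U V G D"
begin

abbreviation E :: "2 \<Rightarrow> 'a ^ 2" where "E \<equiv> basis_field"
abbreviation fields :: "('a ^ 2) set" where "fields \<equiv> vector_fields U V"

text \<open>Christoffel symbols of the first kind, with the lowered index last.\<close>

definition \<Gamma> :: "2 \<Rightarrow> 2 \<Rightarrow> 2 \<Rightarrow> 'a" where
  "\<Gamma> i j k = G (D i (E j)) (E k)"

lemma fields_component: "X \<in> fields \<Longrightarrow> X $ i \<in> smooth"
  by (simp add: vector_fields_def)

lemma basis_fields: "E i \<in> fields"
  by (simp add: vector_fields_def basis_field_def axis_def smooth_one smooth_zero)

lemma fields_add: "X \<in> fields \<Longrightarrow> Y \<in> fields \<Longrightarrow> X + Y \<in> fields"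
  and fields_diff: "X \<in> fields \<Longrightarrow> Y \<in> fields \<Longrightarrow> X - Y \<in> fields"
  and fields_scale: "a \<in> smooth \<Longrightarrow> X \<in> fields \<Longrightarrow> a *s X \<in> fields"
  by (simp_all add: vector_fields_def smooth_intros)

lemma fields_decompose: "X = X $ 1 *s E 1 + X $ 2 *s E 2"
  by (simp add: vec_eq_iff forall_2 basis_field_def axis_def)

lemmas metric_axioms = metric[unfolded riemannian_metric_def]
lemmas connection_axioms = connection[unfolded levi_civita_connection_def]

lemma metric_smooth: "X \<in> fields \<Longrightarrow> Y \<in> fields \<Longrightarrow> G X Y \<in> smooth"
  using metric_axioms[THEN conjunct1] by blast

lemma metric_add:
  "X \<in> fields \<Longrightarrow> Y \<in> fields \<Longrightarrow> Z \<in> fields \<Longrightarrow> G (X + Y) Z = G X Z + G Y Z"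
  using metric_axioms[THEN conjunct2, THEN conjunct1] by simp

lemma metric_scale:
  "a \<in> smooth \<Longrightarrow> X \<in> fields \<Longrightarrow> Y \<in> fields \<Longrightarrow> G (a *s X) Y = a * G X Y"
  using metric_axioms[THEN conjunct2, THEN conjunct2, THEN conjunct1] by simp

lemma metric_basis_commute: "G (E i) (E j) = G (E j) (E i)"
  using metric_axioms by (elim conjE allE)

lemma metric_diff:
  assumes "X \<in> fields" "Y \<in> fields" "Z \<in> fields"
  shows "G (X - Y) Z = G X Z - G Y Z"
  using metric_add[of "X - Y" Y Z] assms by (simp add: fields_diff)

lemma connection_fields: "X \<in> fields \<Longrightarrow> D i X \<in> fields"
  using connection_axioms[THEN conjunct1] by blast

lemma connection_add:
  "X \<in> fields \<Longrightarrow> Y \<in> fields \<Longrightarrow> D i (X + Y) = D i X + D i Y"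
  using connection_axioms[THEN conjunct2, THEN conjunct1] by simp

lemma connection_scale:
  "a \<in> smooth \<Longrightarrow> X \<in> fields \<Longrightarrow> D i (a *s X) = \<delta> i a *s X + a *s D i X"
  using connection_axioms[THEN conjunct2, THEN conjunct2, THEN conjunct2, THEN conjunct1] by simp

lemma koszul:
  "\<Gamma> i j k = (1/2) *\<^sub>R (\<delta> i (G (E j) (E k)) + \<delta> j (G (E i) (E k)) - \<delta> k (G (E i) (E j)))"
  using connection_axioms[THEN conjunct2, THEN conjunct2, THEN conjunct2, THEN conjunct2]
  by (simp add: Let_def metric_matrix_def \<Gamma>_def)

lemma smooth_\<Gamma>: "\<Gamma> i j k \<in> smooth"
  unfolding \<Gamma>_def by (intro metric_smooth connection_fields basis_fields)

lemma metric_expand: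
  assumes "X \<in> fields" "Y \<in> fields"
  shows "G X Y = (\<Sum>m\<in>UNIV. X $ m * G (E m) Y)"
  by (subst fields_decompose[of X])
     (simp add: sum_2 metric_add metric_scale fields_scale fields_component basis_fields assms)

lemma connection_expand:
  assumes "X \<in> fields"
  shows "D i X = (\<delta> i (X $ 1) *s E 1 + X $ 1 *s D i (E 1)) + (\<delta> i (X $ 2) *s E 2 + X $ 2 *s D i (E 2))"
  by (subst fields_decompose[of X])
     (simp add: connection_add connection_scale fields_scale fields_component basis_fields assms)

text \<open>The metric is symmetric on the basis fields, so in the sum of the two Koszul expressions all
  but two terms cancel in pairs.\<close>

lemma metric_compatible: "\<delta> i (G (E j) (E k)) = \<Gamma> i j k + \<Gamma> i k j"
proof -
  have "\<Gamma> i j k + \<Gamma> i k j = (1/2) *\<^sub>R (\<delta> i (G (E j) (E k)) + \<delta> i (G (E j) (E k)))"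
    unfolding koszul metric_basis_commute[of k j] metric_basis_commute[of k i]
      metric_basis_commute[of j i] scaleR_add_right[symmetric]
    by (simp add: algebra_simps)
  then show ?thesis by (simp flip: scaleR_2)
qed

text \<open>With \<open>X = D i (E k)\<close>, differentiate \<open>\<Gamma> i k l = (\<Sum>m. X $ m * G (E m) (E l))\<close> and compare
  with the Leibniz rule for \<open>D j X\<close>. By metric compatibility the results differ only by the terms
  \<open>X $ m * \<Gamma> j l m\<close>. Since \<open>G\<close> is linear in its first argument, the coefficients of \<open>X\<close> stay
  on the left throughout.\<close>

lemma second_covariant_derivative:
  "G (D j (D i (E k))) (E l) = \<delta> j (\<Gamma> i k l) - (\<Sum>m\<in>UNIV. D i (E k) $ m * \<Gamma> j l m)"
proof -
  define X where "X = D i (E k)"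
  have X: "X \<in> fields" unfolding X_def by (intro connection_fields basis_fields)
  have E: "E m \<in> fields" "D j (E m) \<in> fields" for m by (intro connection_fields basis_fields)+
  have sm: "X $ m \<in> smooth" "G (E m) (E l) \<in> smooth" "\<Gamma> j m l \<in> smooth" "\<Gamma> j l m \<in> smooth" for m
    by (intro fields_component X metric_smooth basis_fields smooth_\<Gamma>)+
  have "G (D j X) (E l) = (\<Sum>m\<in>UNIV. \<delta> j (X $ m) * G (E m) (E l) + X $ m * \<Gamma> j m l)"
    unfolding connection_expand[OF X] sum_2 \<Gamma>_def
    by (simp add: metric_add metric_scale fields_add fields_scale smooth_deriv E sm)
  moreover have "\<delta> j (\<Gamma> i k l) = (\<Sum>m\<in>UNIV. \<delta> j (X $ m) * G (E m) (E l) + X $ m * (\<Gamma> j m l + \<Gamma> j l m))"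
    unfolding \<Gamma>_def[of i k l] X_def[symmetric] metric_expand[OF X E(1)] sum_2
    by (simp add: deriv_add deriv_mult smooth_mult sm metric_compatible)
  ultimately show ?thesis by (simp add: X_def[symmetric] sum_2 algebra_simps)
qed

lemma curvature_eq:
  "curvature G D i j k l = \<delta> j (\<Gamma> i k l) - (\<Sum>m\<in>UNIV. D i (E k) $ m * \<Gamma> j l m)
     - (\<delta> i (\<Gamma> j k l) - (\<Sum>m\<in>UNIV. D j (E k) $ m * \<Gamma> i l m))"
  unfolding curvature_def second_covariant_derivative[symmetric]
  by (intro metric_diff connection_fields basis_fields)

lemma curvature_antisym: "curvature G D j i k l = - curvature G D i j k l"
  unfolding curvature_eq by simp

lemma curvature_same: "curvature G D i i k l = 0"
  unfolding curvature_eq by simp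

text \<open>Derivatives have trace zero, so only the quadratic part of the curvature contributes.\<close>

lemma trace_curvature:
  "\<tau> (curvature G D i j k l) =
     (\<Sum>m\<in>UNIV. \<tau> (D j (E k) $ m * \<Gamma> i l m)) - (\<Sum>m\<in>UNIV. \<tau> (D i (E k) $ m * \<Gamma> j l m))"
proof -
  have "D i (E k) $ m \<in> smooth" for i k m
    by (intro fields_component connection_fields basis_fields)
  then show ?thesis
    unfolding curvature_eq sum_2
    by (simp add: trace_add trace_diff trace_deriv smooth_intros smooth_\<Gamma>)
qed

lemma curvature_smooth: "curvature G D i j k l \<in> smooth"
  unfolding curvature_def by (intro metric_smooth fields_diff connection_fields basis_fields)

end

text \<open>Metrics with constant off-diagonal entry \<open>t\<close> and mutually inverse diagonal entries \<open>a\<close>,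
  \<open>b\<close>, in the application \<open>exp f\<close> and \<open>exp (- f)\<close>. The commutative determinant formula for the
  inverse matrix is valid for them, with determinant \<open>1 - t\<^sup>2\<close>.\<close>

locale torus_unimodular_metric = torus_levi_civita \<theta> U V G D
  for \<theta> :: real and U V :: "'a::cstar_algebra" and G D +
  fixes t :: real and a b :: 'a
  assumes inverse: "a * b = 1" "b * a = 1"
    and nondegenerate: "t\<^sup>2 \<noteq> 1"
    and matrix: "metric_matrix G = vector [vector [a, of_real t], vector [of_real t, b]]"
begin

lemma metric_components:
  "G (E 1) (E 1) = a" "G (E 1) (E 2) = of_real t" "G (E 2) (E 1) = of_real t" "G (E 2) (E 2) = b"
proof -
  have "G (E i) (E j) = metric_matrix G $ i $ j" for i j by (simp add: metric_matrix_def)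
  then show "G (E 1) (E 1) = a" "G (E 1) (E 2) = of_real t" "G (E 2) (E 1) = of_real t"
    "G (E 2) (E 2) = b"
    by (simp_all add: matrix)
qed

lemma smooth_ab: "a \<in> smooth" "b \<in> smooth"
  using metric_smooth[OF basis_fields basis_fields] metric_components by metis+

definition s :: real where "s = 1 / (1 - t\<^sup>2)"

lemma s: "s * (1 - t\<^sup>2) = 1"
  using nondegenerate by (simp add: s_def)

lemma s': "s - s * (t * t) = 1"
  using s by (simp add: algebra_simps power2_eq_square)

lemma inverse_metric_matrix:
  "matrix_inv (metric_matrix G)
     = vector [vector [s *\<^sub>R b, of_real (- s * t)], vector [of_real (- s * t), s *\<^sub>R a]]"
proof (rule matrix_inv_eqI)
  have one: "s *\<^sub>R 1 - (s * (t * t)) *\<^sub>R 1 = (1 :: 'a)"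
    by (simp only: s' scaleR_one flip: scaleR_diff_left)
  show "metric_matrix G **
      vector [vector [s *\<^sub>R b, of_real (- s * t)], vector [of_real (- s * t), s *\<^sub>R a]] = mat 1"
    "vector [vector [s *\<^sub>R b, of_real (- s * t)], vector [of_real (- s * t), s *\<^sub>R a]]
      ** metric_matrix G = mat 1"
    using one unfolding of_real_def
    by (simp_all add: matrix vec_eq_iff forall_2 matrix_matrix_mult_def sum_2 mat_def inverse
        of_real_def[symmetric] of_real_mult_eq_scaleR mult_of_real_eq_scaleR mult_ac)
qed

text \<open>Antisymmetry in the first two indices leaves the antisymmetrised products of entries of the
  inverse metric. Its off-diagonal entries are scalar and the diagonal ones commute, so these
  products vanish for equal last indices and otherwise are \<open>s\<close> or \<open>- s\<close>.\<close>

lemma scalar_curvature_eq: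
  "scalar_curvature G D = s *\<^sub>R (curvature G D 1 2 1 2 - curvature G D 1 2 2 1)"
proof -
  define h where "h = matrix_inv (metric_matrix G)"
  have h: "h $ 1 $ 1 = s *\<^sub>R b" "h $ 1 $ 2 = of_real (- s * t)" "h $ 2 $ 1 = of_real (- s * t)"
    "h $ 2 $ 2 = s *\<^sub>R a"
    by (simp_all add: h_def inverse_metric_matrix)
  have ss: "s * s - s * t * (s * t) = s"
    using arg_cong[OF s', of "(*) s"] by (simp add: algebra_simps)
  have det: "(s * s) *\<^sub>R 1 - (s * t * (s * t)) *\<^sub>R 1 = s *\<^sub>R (1 :: 'a)"
    by (simp only: ss flip: scaleR_diff_left)
  have prods: "(s *\<^sub>R b) * (s *\<^sub>R a) = (s * s) *\<^sub>R 1" "(s *\<^sub>R a) * (s *\<^sub>R b) = (s * s) *\<^sub>R 1"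
    "of_real (- s * t) * of_real (- s * t) = (s * t * (s * t)) *\<^sub>R (1 :: 'a)"
    by (simp_all only: mult_scaleR_left mult_scaleR_right scaleR_scaleR inverse
        of_real_def mult_1 mult_minus_left mult_minus_right minus_minus)
  have "scalar_curvature G D
      = (h $ 1 $ 1 * h $ 2 $ 1 - h $ 2 $ 1 * h $ 1 $ 1) * curvature G D 1 2 1 1
      + (h $ 1 $ 1 * h $ 2 $ 2 - h $ 2 $ 1 * h $ 1 $ 2) * curvature G D 1 2 1 2
      + (h $ 1 $ 2 * h $ 2 $ 1 - h $ 2 $ 2 * h $ 1 $ 1) * curvature G D 1 2 2 1
      + (h $ 1 $ 2 * h $ 2 $ 2 - h $ 2 $ 2 * h $ 1 $ 2) * curvature G D 1 2 2 2"
    unfolding scalar_curvature_def Let_def h_def[symmetric] sum_2 curvature_same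
      curvature_antisym[of 2 1]
    by (simp add: algebra_simps)
  also have "h $ 1 $ 1 * h $ 2 $ 1 - h $ 2 $ 1 * h $ 1 $ 1 = 0"
    unfolding h by (simp only: of_real_mult_eq_scaleR mult_of_real_eq_scaleR) simp
  also have "h $ 1 $ 2 * h $ 2 $ 2 - h $ 2 $ 2 * h $ 1 $ 2 = 0"
    unfolding h by (simp only: of_real_mult_eq_scaleR mult_of_real_eq_scaleR) simp
  also have "h $ 1 $ 1 * h $ 2 $ 2 - h $ 2 $ 1 * h $ 1 $ 2 = s *\<^sub>R 1"
    unfolding h prods det ..
  also have "h $ 1 $ 2 * h $ 2 $ 1 - h $ 2 $ 2 * h $ 1 $ 1 = - (s *\<^sub>R 1)"
    unfolding h prods det[symmetric] by simp
  finally show ?thesis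
    by (simp add: scaleR_diff_right)
qed

lemma raise_index:
  assumes "X \<in> fields"
  shows "X $ 1 = s *\<^sub>R (G X (E 1) * b - t *\<^sub>R G X (E 2))"
    and "X $ 2 = s *\<^sub>R (G X (E 2) * a - t *\<^sub>R G X (E 1))"
proof -
  have lower: "G X (E 1) = X $ 1 * a + t *\<^sub>R (X $ 2)" "G X (E 2) = t *\<^sub>R (X $ 1) + X $ 2 * b"
    using metric_expand[OF assms basis_fields]
    by (simp_all add: sum_2 metric_components mult_of_real_eq_scaleR)
  have one: "s *\<^sub>R x - (s * (t * t)) *\<^sub>R x = x" for x :: 'a
    by (simp only: s' scaleR_one flip: scaleR_diff_left)
  show "X $ 1 = s *\<^sub>R (G X (E 1) * b - t *\<^sub>R G X (E 2))"
    "X $ 2 = s *\<^sub>R (G X (E 2) * a - t *\<^sub>R G X (E 1))"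
    using one by (simp_all add: lower algebra_simps inverse)
qed

lemma trace_contraction:
  "(\<Sum>m\<in>UNIV. \<tau> (D i (E k) $ m * \<Gamma> j l m)) = s * \<tau>
     (\<Gamma> i k 1 * b * \<Gamma> j l 1 + \<Gamma> i k 2 * a * \<Gamma> j l 2
       - t *\<^sub>R (\<Gamma> i k 2 * \<Gamma> j l 1) - t *\<^sub>R (\<Gamma> i k 1 * \<Gamma> j l 2))"
proof -
  have X: "D i (E k) \<in> fields" by (intro connection_fields basis_fields)
  have "(\<Sum>m\<in>UNIV. \<tau> (D i (E k) $ m * \<Gamma> j l m))
      = \<tau> (D i (E k) $ 1 * \<Gamma> j l 1 + D i (E k) $ 2 * \<Gamma> j l 2)"
    unfolding sum_2 by (intro trace_add[symmetric] smooth_mult fields_component X smooth_\<Gamma>)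
  also have "D i (E k) $ 1 * \<Gamma> j l 1 + D i (E k) $ 2 * \<Gamma> j l 2 = s *\<^sub>R
     (\<Gamma> i k 1 * b * \<Gamma> j l 1 + \<Gamma> i k 2 * a * \<Gamma> j l 2
       - t *\<^sub>R (\<Gamma> i k 2 * \<Gamma> j l 1) - t *\<^sub>R (\<Gamma> i k 1 * \<Gamma> j l 2))"
    unfolding raise_index[OF X] \<Gamma>_def[of i k, symmetric] by (simp add: algebra_simps)
  also have "\<tau> \<dots> = s * \<tau>
     (\<Gamma> i k 1 * b * \<Gamma> j l 1 + \<Gamma> i k 2 * a * \<Gamma> j l 2
       - t *\<^sub>R (\<Gamma> i k 2 * \<Gamma> j l 1) - t *\<^sub>R (\<Gamma> i k 1 * \<Gamma> j l 2))"
    by (intro trace_scaleR smooth_intros smooth_\<Gamma> smooth_ab)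
  finally show ?thesis .
qed

lemma smooth_scalar_curvature: "scalar_curvature G D \<in> smooth"
  unfolding scalar_curvature_eq by (intro smooth_intros curvature_smooth)

text \<open>Substituting \<open>\<partial> b = - b (\<partial> a) b\<close> turns each of the four contractions into a combination of
  words in \<open>b\<close>, \<open>x\<close>, \<open>y\<close>. Up to cyclic rotation only the words \<open>x b b x b\<close>, \<open>y y b\<close> and
  \<open>y b x b\<close> occur, with the same multiplicities in all four contractions.\<close>

theorem trace_scalar_curvature: "\<tau> (scalar_curvature G D) = 0"
proof -
  define x where "x = (1/2) *\<^sub>R \<delta> 1 a"
  define y where "y = (1/2) *\<^sub>R \<delta> 2 a"
  have xy: "x \<in> smooth" "y \<in> smooth"
    unfolding x_def y_def by (intro smooth_intros smooth_ab)+
  have db: "(1/2) *\<^sub>R \<delta> 1 b = - (b * x * b)" "(1/2) *\<^sub>R \<delta> 2 b = - (b * y * b)"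
    by (simp_all add: deriv_inverse[OF smooth_ab inverse] x_def y_def)
  have \<Gamma>: "\<Gamma> 1 1 1 = x" "\<Gamma> 1 1 2 = - y" "\<Gamma> 1 2 1 = y" "\<Gamma> 1 2 2 = - (b * x * b)"
    "\<Gamma> 2 1 1 = y" "\<Gamma> 2 1 2 = - (b * x * b)" "\<Gamma> 2 2 1 = b * x * b" "\<Gamma> 2 2 2 = - (b * y * b)"
    unfolding koszul metric_components deriv_of_real
    using db by (simp_all add: x_def y_def minus_equation_iff)
  have cancel: "a * (b * z) = z" "b * (a * z) = z" for z
    by (simp_all add: inverse flip: mult.assoc)
  note smooth = smooth_intros smooth_ab xy
  \<comment> \<open>All rotations that are needed to reach the three representative words, stated for the
    right-nested normal form of products.\<close>
  have cyc: "\<tau> (b * (x * (b * (b * x)))) = \<tau> (x * (b * (b * (x * b))))"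
    "\<tau> (b * (x * (b * (x * b)))) = \<tau> (x * (b * (b * (x * b))))"
    "\<tau> (b * (y * y)) = \<tau> (y * (y * b))" "\<tau> (y * (b * y)) = \<tau> (y * (y * b))"
    "\<tau> (b * (x * (b * y))) = \<tau> (y * (b * (x * b)))"
    "\<tau> (x * (b * (y * b))) = \<tau> (y * (b * (x * b)))"
    "\<tau> (b * (y * (b * x))) = \<tau> (y * (b * (x * b)))"
    using trace_commute[of b "x * (b * (b * x))"] trace_commute[of "b * x * b" "x * b"]
      trace_commute[of b "y * y"] trace_commute[of "y * b" y] trace_commute[of "b * x * b" y]
      trace_commute[of "x * b" "y * b"] trace_commute[of b "y * (b * x)"]
    by (simp_all add: smooth mult.assoc)
  define v where "v = \<tau> (x * (b * (b * (x * b)))) + \<tau> (y * (y * b)) + 2 * t * \<tau> (y * (b * (x * b)))"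
  have contractions:
    "(\<Sum>m\<in>UNIV. \<tau> (D 1 (E 1) $ m * \<Gamma> 2 2 m)) = s * v"
    "(\<Sum>m\<in>UNIV. \<tau> (D 2 (E 2) $ m * \<Gamma> 1 1 m)) = s * v"
    "(\<Sum>m\<in>UNIV. \<tau> (D 1 (E 2) $ m * \<Gamma> 2 1 m)) = s * v"
    "(\<Sum>m\<in>UNIV. \<tau> (D 2 (E 1) $ m * \<Gamma> 1 2 m)) = s * v"
    unfolding trace_contraction \<Gamma> v_def
    by (simp_all add: cancel mult.assoc trace_add trace_scaleR smooth cyc)
  have "\<tau> (curvature G D 1 2 1 2 - curvature G D 1 2 2 1) = 0"
    by (simp add: trace_diff curvature_smooth trace_curvature contractions)
  then show ?thesis
    unfolding scalar_curvature_eq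
    by (simp add: trace_scaleR smooth_diff curvature_smooth)
qed

end


section \<open>The Gauss--Bonnet theorem\<close>

theorem proposition4p6:
  fixes \<theta> t :: real
    and U V f :: "'a::cstar_algebra"
    and G :: "'a ^ 2 \<Rightarrow> 'a ^ 2 \<Rightarrow> 'a"
    and D :: "2 \<Rightarrow> 'a ^ 2 \<Rightarrow> 'a ^ 2"
  assumes "noncommutative_torus \<theta> U V"
    and "f \<in> smooth_torus U V" and "f = star f"
    and "0 \<le> t" and "t < 1"
    and "riemannian_metric U V G"
    and "metric_matrix G = vector [vector [exp f, of_real t], vector [of_real t, exp (- f)]]"
    and "levi_civita_connection U V G D"
  shows "torus_trace U V (scalar_curvature G D * of_real (sqrt (1 - t\<^sup>2))) = 0"
proof -
  have "t\<^sup>2 < 1" using assms(4,5) by (simp add: power_less_one_iff)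
  then interpret torus_unimodular_metric \<theta> U V G D t "exp f" "exp (- f)"
    using assms exp_minus_inverse[of f] exp_minus_inverse[of "- f"] by unfold_locales auto
  show ?thesis
    by (simp only: mult_of_real_eq_scaleR trace_scaleR[OF smooth_scalar_curvature]
        trace_scalar_curvature mult_zero_right)
qed

end
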